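(* Let $k=3$ on the reference equilateral triangle, and consider the spectral difference (SD) method with six interior flux points, each used with the two normals in $x$ and $y$, in either of the symmetric configurations: - $(0,2,0)$: the permutations of the barycentric coordinates $(z_1,z_1,1-2z_1)$ and $(z_2,z_2,1-2z_2)$; - $(0,0,1)$: the permutations of the barycentric coordinates $(z_1,z_2,1-z_1-z_2)$. In neither configuration do there exist parameters $z_1,z_2$ (for which the six points are distinct points of the triangle and the SD degrees of freedom are unisolvent) and $q_0,q_1,q_2\in\mathbb R$ such that $$\tilde{\mathbf Q}\tilde{\mathbf C}_{\mathrm{SD}}+\tilde{\mathbf M}(\tilde{\mathbf C}_{\mathrm{SD}}-\tilde{\mathbf C}_{\mathrm{DG}})=0,$$ where $\tilde{\mathbf Q}$ is the symmetric $10\times10$ matrix whose only (possibly) nonzero entries are, up to symmetry, $$\tilde Q_{4,4}=\tfrac{q_1+4q_0}{5}+q_2\sqrt{\tfrac{48}{175}},\quad \tilde Q_{4,9}=\tfrac{q_0-q_1}{\sqrt5}+q_2\sqrt{\tfrac{3}{35}},\quad \tilde Q_{9,9}=q_1,$$ $$\tilde Q_{7,7}=q_0-q_2\sqrt{\tfrac{16}{21}},\quad \tilde Q_{7,10}=q_2,\quad \tilde Q_{10,10}=q_0 .$$ That is, no such SD scheme belongs to the extended range of stable flux reconstruction schemes for $k=3$.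
   Context: Reference triangle $\hat K$: vertices $(-1,-1/\sqrt3)$, $(1,-1/\sqrt3)$, $(0,2/\sqrt3)$, centroid at the origin. Dubiner basis of polynomials of total degree $\le k$: $\phi_i(x,y)=\frac{2}{3^{1/4}}(1-b)^v\psi_v^{(0,0)}(a)\psi_w^{(2v+1,0)}(b)$, $a=\frac{3x}{2-\sqrt3y}$, $b=\frac{2\sqrt3y-1}{3}$, $v,w\ge0$, $v+w\le k$, $i=w+1+v(2k+3-v)/2$ (indices from 1), with $\psi_n^{(\alpha,\beta)}$ the Jacobi polynomial normalised to unit norm in $L^2([-1,1],(1-s)^\alpha(1+s)^\beta\mathrm ds)$ with positive leading coefficient. It is $L^2(\hat K)$-orthonormal, so the modal mass matrix $\tilde{\mathbf M}$ is the identity. The extended range of stable flux reconstruction schemes for $k=3$ consists of those with modal correction matrix $(\tilde{\mathbf M}+\tilde{\mathbf Q})^{-1}\tilde{\mathbf L}_\partial^T\mathbf W_\partial$ with $\tilde{\mathbf Q}$ as displayed and $\tilde{\mathbf M}+\tilde{\mathbf Q}$ positive definite. Correction matrices. Place $k+1$ distinct flux points on each edge, with outward unit normal. For flux point $j$ on edge $e$ let $\lambda_j$ be the polynomial of degree $k$ on $e$ equal to 1 at $j$ and 0 at the other flux points of $e$. The DG correction matrix is $\tilde{\mathbf C}_{\mathrm{DG}}=\tilde{\mathbf M}^{-1}\tilde{\mathbf L}_\partial^T\mathbf W_\partial$, with $(\tilde{\mathbf L}_\partial^T\mathbf W_\partial)_{mj}=\int_e\phi_m\lambda_j\,\mathrm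 ds$. The Raviart–Thomas space $\mathbb{RT}_k$ is the span of $\mathbb Q_k^2$ and of $(x\phi,y\phi)^T$ for the basis polynomials $\phi$ of degree exactly $k$, where $\mathbb Q_k$ is the space of polynomials of total degree $\le k$. Its SD degrees of freedom are the outward normal components at the boundary flux points and the $x$- and $y$-components at the interior flux points. The SD correction for boundary flux point $j$ is the element $\mathbf h_j\in\mathbb{RT}_k$ with normal component 1 at $j$ and all other degrees of freedom zero (unisolvence means these exist uniquely); column $j$ of $\tilde{\mathbf C}_{\mathrm{SD}}$ contains the coefficients of $\nabla\cdot\mathbf h_j$ in the basis $\phi_i$. *)

theory Defs
  imports
    "HOL-Analysis.Analysis"
    "HOL-Computational_Algebra.Polynomial"
    "Jordan_Normal_Form.Gauss_Jordan_Elimination"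
begin

section \<open>Reference triangle\<close>

(* Vertices are numbered counterclockwise, modulo 3; edge e runs from vertex e to vertex e + 1. *)
definition vertex :: "nat \<Rightarrow> real \<times> real" where
  "vertex e = [(-1, -1 / sqrt 3), (1, -1 / sqrt 3), (0, 2 / sqrt 3)] ! (e mod 3)"

definition ref_triangle :: "(real \<times> real) set" where
  "ref_triangle = convex hull {vertex 0, vertex 1, vertex 2}"

definition edge_point :: "nat \<Rightarrow> real \<Rightarrow> real \<times> real" where
  "edge_point e s = (1 - s) *\<^sub>R vertex e + s *\<^sub>R vertex (e + 1)"

definition edge_length :: "nat \<Rightarrow> real" where
  "edge_length e = dist (vertex e) (vertex (e + 1))"

(* The tangent turned clockwise by a right angle, hence outward for counterclockwise vertices. *)
definition outward_normal :: "nat \<Rightarrow> real \<times> real" where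
  "outward_normal e =
     (let d = vertex (e + 1) - vertex e in (1 / norm d) *\<^sub>R (snd d, - fst d))"

definition barycentric :: "real \<Rightarrow> real \<Rightarrow> real \<Rightarrow> real \<times> real" where
  "barycentric a b c = a *\<^sub>R vertex 0 + b *\<^sub>R vertex 1 + c *\<^sub>R vertex 2"

definition bary_orbit :: "real \<Rightarrow> real \<Rightarrow> real \<Rightarrow> (real \<times> real) set" where
  "bary_orbit a b c =
     {barycentric a b c, barycentric b c a, barycentric c a b,
      barycentric b a c, barycentric a c b, barycentric c b a}"


section \<open>Dubiner basis\<close>

definition jacobi :: "nat \<Rightarrow> nat \<Rightarrow> nat \<Rightarrow> real poly" where
  "jacobi \<alpha> \<beta> n =
     (\<Sum>s\<le>n. Polynomial.smult (of_nat (((n + \<alpha>) choose (n - s)) * ((n + \<beta>) choose s)))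
             ([:-1/2, 1/2:] ^ s * [:1/2, 1/2:] ^ (n - s)))"

(* All coefficients in the sum above contribute positively to the leading one,
   so no sign correction is needed. *)
definition jacobi_normalized :: "nat \<Rightarrow> nat \<Rightarrow> nat \<Rightarrow> real poly" where
  "jacobi_normalized \<alpha> \<beta> n =
     Polynomial.smult (1 / sqrt (integral {-1..1}
              (\<lambda>s. (1 - s) ^ \<alpha> * (1 + s) ^ \<beta> * (poly (jacobi \<alpha> \<beta> n) s)\<^sup>2)))
       (jacobi \<alpha> \<beta> n)"

(* With a = 3x / (2 - sqrt 3 y) and b = (2 sqrt 3 y - 1) / 3 one has (1 - b) a = 2x, so that
   (1 - b)^v psi_v(a) is a polynomial in x and y. It is written out here so that the basis
   functions are polynomials on the whole plane, also where a is undefined;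
   dubiner_vw_eq below gives the usual formula. *)
definition dubiner_vw :: "nat \<Rightarrow> nat \<Rightarrow> real \<times> real \<Rightarrow> real" where
  "dubiner_vw v w = (\<lambda>(x, y).
     let b = (2 * sqrt 3 * y - 1) / 3 in
       2 / root 4 3
       * (\<Sum>j\<le>v. Polynomial.coeff (jacobi_normalized 0 0 v) j * (2 * x) ^ j * (1 - b) ^ (v - j))
       * poly (jacobi_normalized (2 * v + 1) 0 w) b)"

lemma degree_jacobi: "Polynomial.degree (jacobi \<alpha> \<beta> n) \<le> n"
  unfolding jacobi_def
proof (rule degree_sum_le)
  fix s assume "s \<in> {..n}"
  then have "s \<le> n" by simp
  have 1: "Polynomial.degree ([:-1/2, 1/2::real:] ^ s) \<le> s"
    using degree_power_le[of "[:-1/2, 1/2::real:]" s] by simp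
  have 2: "Polynomial.degree ([:1/2, 1/2::real:] ^ (n - s)) \<le> n - s"
    using degree_power_le[of "[:1/2, 1/2::real:]" "n - s"] by simp
  show "Polynomial.degree (Polynomial.smult (of_nat (((n + \<alpha>) choose (n - s)) * ((n + \<beta>) choose s)))
             ([:-1/2, 1/2::real:] ^ s * [:1/2, 1/2:] ^ (n - s))) \<le> n"
    using degree_mult_le[of "[:-1/2, 1/2::real:] ^ s" "[:1/2, 1/2:] ^ (n - s)"]
      degree_smult_le[of "of_nat (((n + \<alpha>) choose (n - s)) * ((n + \<beta>) choose s))"
         "[:-1/2, 1/2::real:] ^ s * [:1/2, 1/2:] ^ (n - s)"] 1 2 \<open>s \<le> n\<close>
    by linarith
qed simp

lemma dubiner_vw_eq:
  fixes x y :: real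
  defines "a \<equiv> 3 * x / (2 - sqrt 3 * y)" and "b \<equiv> (2 * sqrt 3 * y - 1) / 3"
  assumes "sqrt 3 * y \<noteq> 2"
  shows "dubiner_vw v w (x, y) =
    2 / root 4 3 * (1 - b) ^ v * poly (jacobi_normalized 0 0 v) a
      * poly (jacobi_normalized (2 * v + 1) 0 w) b"
proof -
  let ?p = "jacobi_normalized 0 0 v"
  have "Polynomial.degree ?p \<le> v"
    using degree_jacobi degree_smult_le le_trans unfolding jacobi_normalized_def by blast
  then have "poly ?p a = poly (\<Sum>i\<le>v. Polynomial.monom (Polynomial.coeff ?p i) i) a"
    by (simp only: poly_as_sum_of_monoms')
  then have pa: "poly ?p a = (\<Sum>j\<le>v. Polynomial.coeff ?p j * a ^ j)"
    by (simp add: poly_sum poly_monom)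
  define d where "d = 2 - sqrt 3 * y"
  have "d \<noteq> 0" "1 - b = 2 * d / 3"
    using assms(3) by (simp_all add: d_def b_def field_simps)
  moreover have "a = 3 * x / d"
    by (simp add: a_def d_def)
  ultimately have ab: "2 * x = (1 - b) * a"
    by (simp only:) simp
  have "(\<Sum>j\<le>v. Polynomial.coeff ?p j * (2 * x) ^ j * (1 - b) ^ (v - j)) = (1 - b) ^ v * poly ?p a"
    unfolding pa sum_distrib_left
  proof (rule sum.cong[OF refl])
    fix j assume "j \<in> {..v}"
    then have "(1 - b) ^ v = (1 - b) ^ j * (1 - b) ^ (v - j)"
      by (simp flip: power_add)
    then show "Polynomial.coeff ?p j * (2 * x) ^ j * (1 - b) ^ (v - j)
        = (1 - b) ^ v * (Polynomial.coeff ?p j * a ^ j)"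
      by (simp add: ab power_mult_distrib)
  qed
  then show ?thesis
    by (simp add: dubiner_vw_def Let_def b_def)
qed

definition dubiner_index :: "nat \<Rightarrow> nat \<Rightarrow> nat \<Rightarrow> nat" where
  "dubiner_index k v w = w + 1 + v * (2 * k + 3 - v) div 2"

definition dubiner :: "nat \<Rightarrow> nat \<Rightarrow> real \<times> real \<Rightarrow> real" where
  "dubiner k i =
     (let (v, w) = (THE (v, w). v + w \<le> k \<and> i = dubiner_index k v w) in dubiner_vw v w)"

definition num_modes :: "nat \<Rightarrow> nat" where
  "num_modes k = (k + 1) * (k + 2) div 2"


section \<open>Discontinuous Galerkin correction\<close>

(* Rows and columns of matrices are numbered from 0, basis functions from 1. *)
definition mass_matrix :: "nat \<Rightarrow> real mat" where
  "mass_matrix k = mat (num_modes k) (num_modes k)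
     (\<lambda>(m, n). integral ref_triangle (\<lambda>p. dubiner k (m + 1) p * dubiner k (n + 1) p))"

(* t e j is the parameter in [0, 1] of flux point j (numbered 0, ..., k) on edge e. *)
definition edge_flux_params :: "nat \<Rightarrow> (nat \<Rightarrow> nat \<Rightarrow> real) \<Rightarrow> bool" where
  "edge_flux_params k t \<longleftrightarrow> (\<forall>e<3. t e ` {..k} \<subseteq> {0..1} \<and> inj_on (t e) {..k})"

definition edge_lagrange :: "nat \<Rightarrow> (nat \<Rightarrow> nat \<Rightarrow> real) \<Rightarrow> nat \<Rightarrow> nat \<Rightarrow> real poly" where
  "edge_lagrange k t e j =
     (THE p. Polynomial.degree p = k \<and> (\<forall>l\<le>k. poly p (t e l) = (if l = j then 1 else 0)))"

(* Boundary flux points are numbered edge by edge: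
   column c belongs to flux point c mod (k + 1) on edge c div (k + 1). *)
definition boundary_matrix :: "nat \<Rightarrow> (nat \<Rightarrow> nat \<Rightarrow> real) \<Rightarrow> real mat" where
  "boundary_matrix k t = mat (num_modes k) (3 * (k + 1))
     (\<lambda>(m, c). let e = c div (k + 1); j = c mod (k + 1) in
        edge_length e * integral {0..1}
          (\<lambda>s. dubiner k (m + 1) (edge_point e s) * poly (edge_lagrange k t e j) s))"

definition C_DG :: "nat \<Rightarrow> (nat \<Rightarrow> nat \<Rightarrow> real) \<Rightarrow> real mat" where
  "C_DG k t = the (mat_inverse (mass_matrix k)) * boundary_matrix k t"


section \<open>Spectral difference correction\<close>

definition poly_space :: "nat \<Rightarrow> (real \<times> real \<Rightarrow> real) set" where
  "poly_space k = {f. \<exists>c. f = (\<lambda>(x, y). \<Sum>i\<le>k. \<Sum>j\<le>k - i. c i j * x ^ i * y ^ j)}"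

definition RT_space :: "nat \<Rightarrow> (real \<times> real \<Rightarrow> real \<times> real) set" where
  "RT_space k = {h. \<exists>f\<in>poly_space k. \<exists>g\<in>poly_space k. \<exists>c.
     h = (\<lambda>(x, y). let r = (\<Sum>v\<le>k. c v * dubiner_vw v (k - v) (x, y)) in
                     (f (x, y) + x * r, g (x, y) + y * r))}"

(* h has normal component g e j at boundary flux point j of edge e and
   both components of u p at each interior flux point p. *)
definition has_SD_dofs ::
  "nat \<Rightarrow> (nat \<Rightarrow> nat \<Rightarrow> real) \<Rightarrow> (real \<times> real) set \<Rightarrow> (nat \<Rightarrow> nat \<Rightarrow> real)
    \<Rightarrow> (real \<times> real \<Rightarrow> real \<times> real) \<Rightarrow> (real \<times> real \<Rightarrow> real \<times> real) \<Rightarrow> bool" where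
  "has_SD_dofs k t P g u h \<longleftrightarrow>
     (\<forall>e<3. \<forall>j\<le>k. inner (h (edge_point e (t e j))) (outward_normal e) = g e j)
     \<and> (\<forall>p\<in>P. h p = u p)"

definition SD_unisolvent ::
  "nat \<Rightarrow> (nat \<Rightarrow> nat \<Rightarrow> real) \<Rightarrow> (real \<times> real) set \<Rightarrow> bool" where
  "SD_unisolvent k t P \<longleftrightarrow> (\<forall>g u. \<exists>!h. h \<in> RT_space k \<and> has_SD_dofs k t P g u h)"

definition SD_field ::
  "nat \<Rightarrow> (nat \<Rightarrow> nat \<Rightarrow> real) \<Rightarrow> (real \<times> real) set \<Rightarrow> nat \<Rightarrow> nat
    \<Rightarrow> (real \<times> real \<Rightarrow> real \<times> real)" where
  "SD_field k t P e j = (THE h. h \<in> RT_space k \<and>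
     has_SD_dofs k t P (\<lambda>e' j'. if e' = e \<and> j' = j then 1 else 0) (\<lambda>_. (0, 0)) h)"

definition divergence :: "(real \<times> real \<Rightarrow> real \<times> real) \<Rightarrow> real \<times> real \<Rightarrow> real" where
  "divergence h = (\<lambda>(x, y). deriv (\<lambda>x'. fst (h (x', y))) x + deriv (\<lambda>y'. snd (h (x, y'))) y)"

definition modal_coeffs :: "nat \<Rightarrow> (real \<times> real \<Rightarrow> real) \<Rightarrow> real Matrix.vec" where
  "modal_coeffs k f = (THE a. a \<in> carrier_vec (num_modes k) \<and>
     (\<forall>p. f p = (\<Sum>m<num_modes k. vec_index a m * dubiner k (m + 1) p)))"

definition C_SD ::
  "nat \<Rightarrow> (nat \<Rightarrow> nat \<Rightarrow> real) \<Rightarrow> (real \<times> real) set \<Rightarrow> real mat" where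
  "C_SD k t P = mat (num_modes k) (3 * (k + 1))
     (\<lambda>(m, c). vec_index
        (modal_coeffs k (divergence (SD_field k t P (c div (k + 1)) (c mod (k + 1))))) m)"

definition config_020 :: "real \<Rightarrow> real \<Rightarrow> (real \<times> real) set" where
  "config_020 z1 z2 = bary_orbit z1 z1 (1 - 2 * z1) \<union> bary_orbit z2 z2 (1 - 2 * z2)"

definition config_001 :: "real \<Rightarrow> real \<Rightarrow> (real \<times> real) set" where
  "config_001 z1 z2 = bary_orbit z1 z2 (1 - z1 - z2)"


section \<open>Extended range of stable flux reconstruction schemes for degree 3\<close>

definition Q_entry :: "real \<Rightarrow> real \<Rightarrow> real \<Rightarrow> nat \<times> nat \<Rightarrow> real" where
  "Q_entry q0 q1 q2 ij =
     (if ij = (4, 4) then (q1 + 4 * q0) / 5 + q2 * sqrt (48 / 175)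
      else if ij \<in> {(4, 9), (9, 4)} then (q0 - q1) / sqrt 5 + q2 * sqrt (3 / 35)
      else if ij = (9, 9) then q1
      else if ij = (7, 7) then q0 - q2 * sqrt (16 / 21)
      else if ij \<in> {(7, 10), (10, 7)} then q2
      else if ij = (10, 10) then q0
      else 0)"

definition Q_matrix :: "real \<Rightarrow> real \<Rightarrow> real \<Rightarrow> real mat" where
  "Q_matrix q0 q1 q2 = mat 10 10 (\<lambda>(m, n). Q_entry q0 q1 q2 (m + 1, n + 1))"

definition positive_definite :: "nat \<Rightarrow> real mat \<Rightarrow> bool" where
  "positive_definite n A \<longleftrightarrow> A \<in> carrier_mat n n \<and> transpose_mat A = A \<and>
     (\<forall>x\<in>carrier_vec n. x \<noteq> 0\<^sub>v n \<longrightarrow> scalar_prod x (A *\<^sub>v x) > 0)"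

definition extended_range :: "(nat \<Rightarrow> nat \<Rightarrow> real) \<Rightarrow> real mat set" where
  "extended_range t =
     {the (mat_inverse (mass_matrix 3 + Q_matrix q0 q1 q2)) * boundary_matrix 3 t | q0 q1 q2.
        positive_definite 10 (mass_matrix 3 + Q_matrix q0 q1 q2)}"

end

(* Let h be a field in RT_3 vanishing at the interior flux points. It is a combination of the h_j, so
   (M + Q) C_SD = L^T W pairs the coefficients of div h with every basis function phi: the result is
   the integral of phi (h . n) over the boundary. The rows of Q belonging to degree at most 2 are zero,
   and the coefficient vector is zero if div h = 0. Hence
     the integral of phi div h equals that of phi (h . n) for deg phi <= 2,
     the integral of phi (h . n) is zero for deg phi <= 3 if div h = 0,
   whatever q_0, q_1, q_2 are. Put p = a + b and q = a b with a = 1 - 3 z_1 and b = 1 - 3 z_2 for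
   (0,2,0), and p = 0, q = - 3 rho / 4 for (0,0,1), where all six points lie on the circle
   x^2 + y^2 = rho. Three explicit fields with coefficients in p and q then vanish at the interior
   flux points, and testing them gives 2 - 2p + 5q = 0, 4 - 7p + 7q = 0 and
   p/10 + (q - p^2)/4 + q^2 = 0, which are inconsistent. *)

theory Submission
  imports Defs "Jordan_Normal_Form.Determinant"
begin

section \<open>Explicit form of the Dubiner basis\<close>

text \<open>By the divergence theorem the first identity says that the integral of (grad phi) . h
  over the triangle vanishes, so it restricts h as soon as phi is not constant. The fields come from
  the symmetry group of the triangle, whose invariants up to degree 4 are spanned by 1, r^2 = x^2 +
  y^2, c = y^3 - 3 x^2 y and r^4. The gradient of an invariant function points along each symmetry
  axis. A quartic r^4 / 4 + alpha c + beta r^2 therefore has critical points at all six points of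
  (0,2,0) under just two conditions, which fix alpha and beta; this yields a gradient and its
  divergence-free rotation. The third field puts an invariant cubic vanishing at the six points into
  one component. For (0,0,1), where p = 0, all three contain the factor r^2 + 4 q / 3, which
  vanishes on the circle. The normal component of the rotated gradient is the tangential derivative
  of an invariant function, so it pairs to zero with every invariant phi. A phi changing sign under
  reflections is required, and the lowest one is x^3 - 3 x y^2: hence the need for an identity that
  reaches degree 3.\<close>

lemma poly_jacobi_at_1: "poly (jacobi \<alpha> \<beta> n) 1 = of_nat ((n + \<alpha>) choose n)"
proof -
  \<comment> \<open>Every summand with s > 0 carries the factor \<open>[:-1/2, 1/2:]\<close>, which
    vanishes at 1.\<close>
  have "poly (jacobi \<alpha> \<beta> n) 1 =
      (\<Sum>s\<le>n. if s = 0 then of_nat ((n + \<alpha>) choose n) else 0)"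
    unfolding jacobi_def poly_sum by (intro sum.cong) (auto simp: poly_power)
  then show ?thesis by simp
qed

lemma jacobi_nonzero: "jacobi \<alpha> \<beta> n \<noteq> 0"
proof
  assume "jacobi \<alpha> \<beta> n = 0"
  then have "(n + \<alpha>) choose n = 0"
    using poly_jacobi_at_1[of \<alpha> \<beta> n] by simp
  then show False by simp
qed

text \<open>The integrand is continuous and nonnegative, so integral 0 would make it zero on the
  whole interval; the weight is positive inside, and the polynomial would have infinitely many
  roots. This keeps the normalisation away from a division by 0.\<close>

lemma jacobi_norm_pos:
  "integral {-1..1} (\<lambda>s. (1 - s) ^ \<alpha> * (1 + s) ^ \<beta> * (poly (jacobi \<alpha> \<beta> n) s)\<^sup>2) > 0"
  (is "integral _ ?f > 0")
proof -
  have cont: "continuous_on {-1..1} ?f"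
    by (intro continuous_intros)
  then have int: "?f integrable_on {-1..1}"
    by (rule integrable_continuous_interval)
  have nonneg: "0 \<le> ?f s" if "s \<in> {-1..1}" for s
    using that by auto
  then have "integral {-1..1} ?f \<ge> 0"
    using int by (intro integral_nonneg) auto
  moreover have "integral {-1..1} ?f \<noteq> 0"
  proof
    assume "integral {-1..1} ?f = 0"
    with int have "(?f has_integral 0) (cbox (-1) 1)"
      by (metis box_real(2) integrable_integral)
    then have zero: "?f s = 0" if "s \<in> {-1..1}" for s
      using has_integral_0_cbox_imp_0[of "-1::real" 1 ?f s] cont nonneg that by auto
    have "poly (jacobi \<alpha> \<beta> n) s = 0" if "s \<in> {-1<..<1}" for s
      using zero[of s] that by auto
    then have "{-1<..<1} \<subseteq> {s. poly (jacobi \<alpha> \<beta> n) s = 0}"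
      by blast
    then show False
      using finite_subset[OF _ poly_roots_finite[OF jacobi_nonzero[of \<alpha> \<beta> n]]]
        infinite_Ioo[of "-1::real" 1] by auto
  qed
  ultimately show ?thesis by linarith
qed

definition jac_norm :: "nat \<Rightarrow> nat \<Rightarrow> real" where
  "jac_norm \<alpha> n = 1 / sqrt (integral {-1..1}
              (\<lambda>s. (1 - s) ^ \<alpha> * (1 + s) ^ 0 * (poly (jacobi \<alpha> 0 n) s)\<^sup>2))"

lemma jac_norm_nz: "jac_norm \<alpha> n \<noteq> 0"
  using jacobi_norm_pos[of \<alpha> 0 n] unfolding jac_norm_def by simp

lemma jacobi_normalized_eq: "jacobi_normalized \<alpha> 0 n = Polynomial.smult (jac_norm \<alpha> n) (jacobi \<alpha> 0 n)"
  unfolding jacobi_normalized_def jac_norm_def ..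

text \<open>Collects the normalisation factors of a mode, so that the rest has rational coefficients
  in X and b. It stays unevaluated; the argument takes from it that it is nonzero.\<close>

definition dubiner_const :: "nat \<Rightarrow> nat \<Rightarrow> real" where
  "dubiner_const v w = 2 / root 4 3 * jac_norm 0 v * jac_norm (2 * v + 1) w"

lemma dubiner_const_nz: "dubiner_const v w \<noteq> 0"
  unfolding dubiner_const_def by (simp add: jac_norm_nz)

lemma dubiner_vw_expand:
  "dubiner_vw v w (x, (3 * b + 1) / (2 * sqrt 3)) =
    dubiner_const v w * ((\<Sum>j\<le>v. Polynomial.coeff (jacobi 0 0 v) j * (2 * x) ^ j * (1 - b) ^ (v - j))
       * poly (jacobi (2 * v + 1) 0 w) b)"
proof -
  have "(2 * sqrt 3 * ((3 * b + 1) / (2 * sqrt 3)) - 1) / 3 = b"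
    by (simp add: field_simps)
  then show ?thesis
    unfolding dubiner_vw_def prod.case Let_def
    by (simp add: jacobi_normalized_eq dubiner_const_def sum_distrib_left sum_distrib_right mult_ac)
qed

section \<open>Explicit Jacobi polynomials and modes up to degree 3\<close>

lemma jacobi_values:
  "jacobi \<alpha> 0 0 = 1"
  "jacobi 0 0 (1) = [:0, 1:]"
  "jacobi 0 0 2 = [:-1/2, 0, 3/2:]"
  "jacobi 0 0 3 = [:0, -3/2, 0, 5/2:]"
  "jacobi (1) 0 (1) = [:1/2, 3/2:]"
  "jacobi (1) 0 2 = [:-1/2, 1, 5/2:]"
  "jacobi (1) 0 3 = [:-3/8, -15/8, 15/8, 35/8:]"
  "jacobi 3 0 (1) = [:3/2, 5/2:]"
  "jacobi 3 0 2 = [:1/4, 9/2, 21/4:]"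
  "jacobi 5 0 (1) = [:5/2, 7/2:]"
  unfolding jacobi_def
  by (simp_all add: numeral_eq_Suc field_simps one_pCons)

text \<open>Inverse of \<open>dubiner_index 3\<close>, shifted to count from 0: entry m is the pair
  (v, w) with index m + 1.\<close>

definition mode :: "nat \<Rightarrow> nat \<times> nat" where
  "mode m = [(0,0),(0,1),(0,2),(0,3),(1,0),(1,1),(1,2),(2,0),(2,1),(3,0)] ! m"

lemma lessThan_10: "{..<10} = {0,1,2,3,4,5,6,7,8,9::nat}"
  by auto

text \<open>The index is injective on the ten pairs with v + w <= 3, which is checked case by case,
  so the definite description in \<open>dubiner\<close> picks (v, w).\<close>

lemma dubiner_3_index:
  assumes "v + w \<le> 3"
  shows "dubiner 3 (dubiner_index 3 v w) = dubiner_vw v w"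
proof -
  have small: "v = 0 \<or> v = 1 \<or> v = 2 \<or> v = 3" if "v + w \<le> 3" for v w :: nat
    using that by linarith
  have "(THE (v', w'). v' + w' \<le> 3 \<and> dubiner_index 3 v w = dubiner_index 3 v' w') = (v, w)"
  proof (rule the_equality)
    fix z assume z: "case z of (v', w') \<Rightarrow> v' + w' \<le> 3 \<and> dubiner_index 3 v w = dubiner_index 3 v' w'"
    obtain v' w' where "z = (v', w')" by (cases z)
    with z assms small[of v w] small[of v' w'] show "z = (v, w)"
      by (auto simp: dubiner_index_def)
  qed (use assms in auto)
  then show ?thesis
    unfolding dubiner_def by simp
qed

lemma dubiner_3_mode:
  assumes "m < 10"
  shows "dubiner 3 (m + 1) = dubiner_vw (fst (mode m)) (snd (mode m))"
proof -
  have "m \<in> {..<10}" using assms by simp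
  then have "fst (mode m) + snd (mode m) \<le> 3 \<and> dubiner_index 3 (fst (mode m)) (snd (mode m)) = m + 1"
    unfolding lessThan_10 by (auto simp: mode_def dubiner_index_def)
  then show ?thesis using dubiner_3_index by metis
qed

(* The mode m, up to its normalisation, in the coordinates X = 2x = (1 - b) a and b of the Dubiner basis. *)
definition shape :: "nat \<Rightarrow> real \<Rightarrow> real \<Rightarrow> real" where
  "shape m X b =
    [1, (1 + 3 * b) / 2, (- 1 + 2 * b + 5 * b^2) / 2, (- 3 - 15 * b + 15 * b^2 + 35 * b^3) / 8,
     X, X * (3 + 5 * b) / 2, X * (1 + 18 * b + 21 * b^2) / 4,
     (3 * X^2 - (1 - b)^2) / 2, (3 * X^2 - (1 - b)^2) * (5 + 7 * b) / 4,
     (5 * X^3 - 3 * X * (1 - b)^2) / 2] ! m"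

definition mode_const :: "nat \<Rightarrow> real" where
  "mode_const m = dubiner_const (fst (mode m)) (snd (mode m))"

lemma mode_const_nz: "mode_const m \<noteq> 0"
  unfolding mode_const_def by (rule dubiner_const_nz)

text \<open>Legendre polynomials homogenised to degree v: with B = 1 - b and X = a B these are the
  factors (1 - b)^v P_v(a) of the modes, free of the division that defines a.\<close>

lemma homogenized_legendre:
  "(\<Sum>j\<le>0. Polynomial.coeff (jacobi 0 0 0) j * X ^ j * B ^ (0 - j)) = 1"
  "(\<Sum>j\<le>1. Polynomial.coeff (jacobi 0 0 (1)) j * X ^ j * B ^ (1 - j)) = X"
  "(\<Sum>j\<le>2. Polynomial.coeff (jacobi 0 0 2) j * X ^ j * B ^ (2 - j)) = (3 * X^2 - B^2) / 2"
  "(\<Sum>j\<le>3. Polynomial.coeff (jacobi 0 0 3) j * X ^ j * B ^ (3 - j)) = (5 * X^3 - 3 * X * B^2) / 2"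
  unfolding jacobi_values
  by (simp_all add: eval_nat_numeral coeff_pCons field_simps)

lemma dubiner_shape:
  assumes "m < 10"
  shows "dubiner 3 (m + 1) (X / 2, (3 * b + 1) / (2 * sqrt 3)) = mode_const m * shape m X b"
proof -
  have "m \<in> {..<10}" using assms by simp
  then have "(\<Sum>j\<le>fst (mode m). Polynomial.coeff (jacobi 0 0 (fst (mode m))) j * X ^ j * (1 - b) ^ (fst (mode m) - j))
       * poly (jacobi (2 * fst (mode m) + 1) 0 (snd (mode m))) b = shape m X b"
    unfolding lessThan_10
    by (auto simp: mode_def shape_def homogenized_legendre simp del: sum.atMost_Suc One_nat_def)
      (simp_all add: jacobi_values power2_eq_square power3_eq_cube field_simps del: One_nat_def)
  then show ?thesis
    using dubiner_vw_expand[of "fst (mode m)" "snd (mode m)" "X / 2" b]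
    unfolding dubiner_3_mode[OF assms] mode_const_def by simp
qed

(* The ten lattice points with i + j <= 3 are unisolvent for cubics; scaled this way they lie in the triangle. *)
lemma shape_independent:
  assumes *: "\<And>i j. i + j \<le> 3 \<Longrightarrow>
    (\<Sum>m<10. a m * shape m (real i / 4) (real j / 4 - 1)) = 0"
  shows "\<forall>m<10. a m = 0"
proof -
  have e00: "(1) * a 0 + (-1) * a 1 + (1) * a 2 + (-1) * a 3 + (-2) * a 7 + (2) * a 8 = 0"
    using *[of 0 0] by (simp add: lessThan_10 shape_def field_simps power2_eq_square power3_eq_cube)
  have e01: "(1) * a 0 + (-5/8) * a 1 + (5/32) * a 2 + (123/512) * a 3 + (-49/32) * a 7 + (49/256) * a 8 = 0"
    using *[of 0 1] by (simp add: lessThan_10 shape_def field_simps power2_eq_square power3_eq_cube)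
  have e02: "(1) * a 0 + (-1/4) * a 1 + (-3/8) * a 2 + (31/64) * a 3 + (-9/8) * a 7 + (-27/32) * a 8 = 0"
    using *[of 0 2] by (simp add: lessThan_10 shape_def field_simps power2_eq_square power3_eq_cube)
  have e03: "(1) * a 0 + (1/8) * a 1 + (-19/32) * a 2 + (73/512) * a 3 + (-25/32) * a 7 + (-325/256) * a 8 = 0"
    using *[of 0 3] by (simp add: lessThan_10 shape_def field_simps power2_eq_square power3_eq_cube)
  have e10: "(1) * a 0 + (-1) * a 1 + (1) * a 2 + (-1) * a 3 + (1/4) * a 4 + (-1/4) * a 5 + (1/4) * a 6 + (-61/32) * a 7 + (61/32) * a 8 + (-187/128) * a 9 = 0"
    using *[of 1 0] by (simp add: lessThan_10 shape_def field_simps power2_eq_square power3_eq_cube)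
  have e11: "(1) * a 0 + (-5/8) * a 1 + (5/32) * a 2 + (123/512) * a 3 + (1/4) * a 4 + (-3/32) * a 5 + (-11/256) * a 6 + (-23/16) * a 7 + (23/128) * a 8 + (-71/64) * a 9 = 0"
    using *[of 1 1] by (simp add: lessThan_10 shape_def field_simps power2_eq_square power3_eq_cube)
  have e12: "(1) * a 0 + (-1/4) * a 1 + (-3/8) * a 2 + (31/64) * a 3 + (1/4) * a 4 + (1/16) * a 5 + (-11/64) * a 6 + (-33/32) * a 7 + (-99/128) * a 8 + (-103/128) * a 9 = 0"
    using *[of 1 2] by (simp add: lessThan_10 shape_def field_simps power2_eq_square power3_eq_cube)
  have e20: "(1) * a 0 + (-1) * a 1 + (1) * a 2 + (-1) * a 3 + (1/2) * a 4 + (-1/2) * a 5 + (1/2) * a 6 + (-13/8) * a 7 + (13/8) * a 8 + (-43/16) * a 9 = 0"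
    using *[of 2 0] by (simp add: lessThan_10 shape_def field_simps power2_eq_square power3_eq_cube)
  have e21: "(1) * a 0 + (-5/8) * a 1 + (5/32) * a 2 + (123/512) * a 3 + (1/2) * a 4 + (-3/16) * a 5 + (-11/128) * a 6 + (-37/32) * a 7 + (37/256) * a 8 + (-127/64) * a 9 = 0"
    using *[of 2 1] by (simp add: lessThan_10 shape_def field_simps power2_eq_square power3_eq_cube)
  have e30: "(1) * a 0 + (-1) * a 1 + (1) * a 2 + (-1) * a 3 + (3/4) * a 4 + (-3/4) * a 5 + (3/4) * a 6 + (-37/32) * a 7 + (37/32) * a 8 + (-441/128) * a 9 = 0"
    using *[of 3 0] by (simp add: lessThan_10 shape_def field_simps power2_eq_square power3_eq_cube)
  \<comment> \<open>Differences in X along rows of constant b: the third difference sees only X^3,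
    hence \<open>a 9\<close>; second differences on two rows give \<open>a 7\<close> and
    \<open>a 8\<close>, first differences on three rows \<open>a 4\<close>, \<open>a 5\<close> and
    \<open>a 6\<close>, and the values at X = 0 the rest.\<close>
  have a9: "a 9 = 0"
    using e00 e10 e20 e30 by linarith
  have a78: "a 7 = 0" "a 8 = 0"
    using e00 e10 e20 e01 e11 e21 a9 by linarith+
  have a456: "a 4 = 0" "a 5 = 0" "a 6 = 0"
    using e00 e10 e01 e11 e02 e12 a9 a78 by linarith+
  have "a 0 = 0" "a 1 = 0" "a 2 = 0" "a 3 = 0"
    using e00 e01 e02 e03 a9 a78 a456 by linarith+
  with a9 a78 a456 have "a m = 0" if "m \<in> {..<10}" for m
    using that unfolding lessThan_10 by auto
  then show ?thesis by auto
qed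

section \<open>Polynomials in the span of the Dubiner basis\<close>

text \<open>The index set is a parameter because two spans occur: all ten modes for cubics, and
  \<open>low_modes\<close> for quadratics, on whose rows Q vanishes.\<close>

definition mode_span :: "nat set \<Rightarrow> (real \<times> real \<Rightarrow> real) set" where
  "mode_span I = {f. \<exists>a. \<forall>p. f p = (\<Sum>m\<in>I. a m * dubiner 3 (m + 1) p)}"

(* The modes of degree at most 2, numbered from 0. *)
abbreviation low_modes :: "nat set" where
  "low_modes \<equiv> {0, 1, 2, 4, 5, 7}"

lemma mode_span_zero: "(\<lambda>p. 0) \<in> mode_span I"
  unfolding mode_span_def by (auto intro: exI[of _ "\<lambda>m. 0"])

lemma mode_span_lincomb:
  assumes "f \<in> mode_span I" "g \<in> mode_span I"
  shows "(\<lambda>p. \<alpha> * f p + \<beta> * g p) \<in> mode_span I"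
proof -
  obtain a b where "\<And>p. f p = (\<Sum>m\<in>I. a m * dubiner 3 (m + 1) p)"
    "\<And>p. g p = (\<Sum>m\<in>I. b m * dubiner 3 (m + 1) p)"
    using assms unfolding mode_span_def by blast
  then have "\<forall>p. \<alpha> * f p + \<beta> * g p = (\<Sum>m\<in>I. (\<alpha> * a m + \<beta> * b m) * dubiner 3 (m + 1) p)"
    by (simp add: sum_distrib_left sum.distrib algebra_simps)
  then show ?thesis
    unfolding mode_span_def by (auto intro: exI[of _ "\<lambda>m. \<alpha> * a m + \<beta> * b m"])
qed

lemma mode_span_sum:
  assumes "finite A" "\<And>l. l \<in> A \<Longrightarrow> f l \<in> mode_span I"
  shows "(\<lambda>p. \<Sum>l\<in>A. c l * f l p) \<in> mode_span I"
  using assms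
proof (induction A rule: finite_induct)
  case (insert l A)
  then show ?case
    using mode_span_lincomb[of "f l" I "\<lambda>p. \<Sum>l\<in>A. c l * f l p" "c l" 1] by simp
qed (simp add: mode_span_zero)

text \<open>The list of coefficients and functions is a certificate: what remains is membership of
  the listed functions and one pointwise identity.\<close>

lemma mode_span_listI:
  assumes "\<forall>(c, f)\<in>set L. f \<in> mode_span I" "\<And>p. h p = (\<Sum>(c, f)\<leftarrow>L. c * f p)"
  shows "h \<in> mode_span I"
  using assms
proof (induction L arbitrary: h)
  case Nil
  then have "h = (\<lambda>p. 0)" by auto
  then show ?case by (simp add: mode_span_zero)
next
  case (Cons cf L)
  obtain c f where cf: "cf = (c, f)" by (cases cf)
  have "(\<lambda>p. c * f p + 1 * (\<Sum>(c, f)\<leftarrow>L. c * f p)) \<in> mode_span I"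
    using Cons.prems(1) cf Cons.IH[of "\<lambda>p. \<Sum>(c, f)\<leftarrow>L. c * f p"]
    by (intro mode_span_lincomb) auto
  moreover have "h = (\<lambda>p. c * f p + 1 * (\<Sum>(c, f)\<leftarrow>L. c * f p))"
    by (rule ext) (simp only: Cons.prems(2) cf list.map sum_list.Cons prod.case mult_1)
  ultimately show ?case by simp
qed

definition coord_X :: "real \<times> real \<Rightarrow> real" where "coord_X p = 2 * fst p"

definition coord_b :: "real \<times> real \<Rightarrow> real" where "coord_b p = (2 * sqrt 3 * snd p - 1) / 3"

lemma cartesian_from_coords: "p = (coord_X p / 2, (3 * coord_b p + 1) / (2 * sqrt 3))"
  by (cases p) (simp add: coord_X_def coord_b_def field_simps)

lemma dubiner_coords: "m < 10 \<Longrightarrow> dubiner 3 (m + 1) p = mode_const m * shape m (coord_X p) (coord_b p)"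
  using dubiner_shape[of m "coord_X p" "coord_b p"] cartesian_from_coords[of p] by simp

lemma shape_in_mode_span:
  assumes "m \<in> I" "finite I" "I \<subseteq> {..<10}"
  shows "(\<lambda>p. shape m (coord_X p) (coord_b p)) \<in> mode_span I"
proof -
  have "shape m (coord_X p) (coord_b p) = (\<Sum>n\<in>I. (if n = m then 1 / mode_const m else 0) * dubiner 3 (n + 1) p)" for p
  proof -
    have "shape m (coord_X p) (coord_b p) = 1 / mode_const m * dubiner 3 (m + 1) p"
      using dubiner_coords[of m p] mode_const_nz[of m] assms by auto
    also have "\<dots> = (\<Sum>n\<in>I. if n = m then 1 / mode_const m * dubiner 3 (n + 1) p else 0)"
      using assms by simp
    also have "\<dots> = (\<Sum>n\<in>I. (if n = m then 1 / mode_const m else 0) * dubiner 3 (n + 1) p)"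
      by (rule sum.cong) auto
    finally show ?thesis .
  qed
  then show ?thesis
    unfolding mode_span_def by (auto intro: exI[of _ "\<lambda>n. if n = m then 1 / mode_const m else 0"])
qed

text \<open>A triangular system: each monomial is a multiple of its mode plus monomials already
  obtained. Each premise lists the modes involved, so that the same facts serve the ten modes and
  the six low ones.\<close>

lemma monomials_in_mode_span:
  assumes "finite I" "I \<subseteq> {..<10}"
  shows "0 \<in> I \<Longrightarrow> (\<lambda>p. 1) \<in> mode_span I"
    and "{0, 1} \<subseteq> I \<Longrightarrow> coord_b \<in> mode_span I"
    and "{0, 1, 2} \<subseteq> I \<Longrightarrow> (\<lambda>p. coord_b p ^ 2) \<in> mode_span I"
    and "{0, 1, 2, 3} \<subseteq> I \<Longrightarrow> (\<lambda>p. coord_b p ^ 3) \<in> mode_span I"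
    and "4 \<in> I \<Longrightarrow> coord_X \<in> mode_span I"
    and "{4, 5} \<subseteq> I \<Longrightarrow> (\<lambda>p. coord_X p * coord_b p) \<in> mode_span I"
    and "{4, 5, 6} \<subseteq> I \<Longrightarrow> (\<lambda>p. coord_X p * coord_b p ^ 2) \<in> mode_span I"
    and "{0, 1, 2, 7} \<subseteq> I \<Longrightarrow> (\<lambda>p. coord_X p ^ 2) \<in> mode_span I"
    and "{0, 1, 2, 3, 7, 8} \<subseteq> I \<Longrightarrow> (\<lambda>p. coord_X p ^ 2 * coord_b p) \<in> mode_span I"
    and "{4, 5, 6, 9} \<subseteq> I \<Longrightarrow> (\<lambda>p. coord_X p ^ 3) \<in> mode_span I"
proof -
  define d where "d m = (\<lambda>p. shape m (coord_X p) (coord_b p))" for m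
  have d: "m \<in> I \<Longrightarrow> d m \<in> mode_span I" for m
    unfolding d_def using shape_in_mode_span assms by blast
  note expand = d_def shape_def power2_eq_square power3_eq_cube field_simps
  show 1: "0 \<in> I \<Longrightarrow> (\<lambda>p. 1) \<in> mode_span I"
    by (rule mode_span_listI[of "[(1, d 0)]"]) (auto simp: d, auto simp: expand)
  show b: "{0, 1} \<subseteq> I \<Longrightarrow> coord_b \<in> mode_span I"
    by (rule mode_span_listI[of "[(2/3, d 1), (-1/3, \<lambda>p. 1)]"]) (auto simp: d 1, auto simp: expand)
  show b2: "{0, 1, 2} \<subseteq> I \<Longrightarrow> (\<lambda>p. coord_b p ^ 2) \<in> mode_span I"
    by (rule mode_span_listI[of "[(2/5, d 2), (1/5, \<lambda>p. 1), (-2/5, coord_b)]"])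
      (auto simp: d 1 b, auto simp: expand)
  show b3: "{0, 1, 2, 3} \<subseteq> I \<Longrightarrow> (\<lambda>p. coord_b p ^ 3) \<in> mode_span I"
    by (rule mode_span_listI[of "[(8/35, d 3), (3/35, \<lambda>p. 1), (15/35, coord_b), (-15/35, \<lambda>p. coord_b p ^ 2)]"])
      (auto simp: d 1 b b2, auto simp: expand)
  show x: "4 \<in> I \<Longrightarrow> coord_X \<in> mode_span I"
    by (rule mode_span_listI[of "[(1, d 4)]"]) (auto simp: d, auto simp: expand)
  show xb: "{4, 5} \<subseteq> I \<Longrightarrow> (\<lambda>p. coord_X p * coord_b p) \<in> mode_span I"
    by (rule mode_span_listI[of "[(2/5, d 5), (-3/5, coord_X)]"]) (auto simp: d x, auto simp: expand)
  show xb2: "{4, 5, 6} \<subseteq> I \<Longrightarrow> (\<lambda>p. coord_X p * coord_b p ^ 2) \<in> mode_span I"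
    by (rule mode_span_listI[of "[(4/21, d 6), (-1/21, coord_X), (-18/21, \<lambda>p. coord_X p * coord_b p)]"])
      (auto simp: d x xb, auto simp: expand)
  show x2: "{0, 1, 2, 7} \<subseteq> I \<Longrightarrow> (\<lambda>p. coord_X p ^ 2) \<in> mode_span I"
    by (rule mode_span_listI[of "[(2/3, d 7), (1/3, \<lambda>p. 1), (-2/3, coord_b), (1/3, \<lambda>p. coord_b p ^ 2)]"])
      (auto simp: d 1 b b2, auto simp: expand)
  show "{0, 1, 2, 3, 7, 8} \<subseteq> I \<Longrightarrow> (\<lambda>p. coord_X p ^ 2 * coord_b p) \<in> mode_span I"
    by (rule mode_span_listI[of "[(4/21, d 8), (-15/21, \<lambda>p. coord_X p ^ 2), (5/21, \<lambda>p. 1),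
          (-3/21, coord_b), (-9/21, \<lambda>p. coord_b p ^ 2), (7/21, \<lambda>p. coord_b p ^ 3)]"])
      (auto simp: d 1 b b2 b3 x2, auto simp: expand)
  show "{4, 5, 6, 9} \<subseteq> I \<Longrightarrow> (\<lambda>p. coord_X p ^ 3) \<in> mode_span I"
    by (rule mode_span_listI[of "[(2/5, d 9), (3/5, coord_X), (-6/5, \<lambda>p. coord_X p * coord_b p), (3/5, \<lambda>p. coord_X p * coord_b p ^ 2)]"])
      (auto simp: d x xb xb2, auto simp: expand)
qed

text \<open>X and b are affine coordinates of the plane, so changing to them preserves the degree;
  the binomial expansion of y^j makes this explicit.\<close>

lemma poly_space_subset_mode_spanI:
  assumes "\<And>i j. i + j \<le> k \<Longrightarrow> (\<lambda>p. coord_X p ^ i * coord_b p ^ j) \<in> mode_span I"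
  shows "poly_space k \<subseteq> mode_span I"
proof
  fix f assume "f \<in> poly_space k"
  then obtain c where f: "f = (\<lambda>(x, y). \<Sum>i\<le>k. \<Sum>j\<le>k - i. c i j * x ^ i * y ^ j)"
    unfolding poly_space_def by blast
  let ?w = "1 / (2 * sqrt 3)"
  have mono: "(\<lambda>p. fst p ^ i * snd p ^ j) \<in> mode_span I" if "i + j \<le> k" for i j
  proof -
    have "(\<lambda>p. \<Sum>l\<le>j. (?w ^ j * of_nat (j choose l) * 3 ^ l / 2 ^ i) * (coord_X p ^ i * coord_b p ^ l)) \<in> mode_span I"
      using that by (intro mode_span_sum assms) auto
    moreover have "fst p ^ i * snd p ^ j =
        (\<Sum>l\<le>j. (?w ^ j * of_nat (j choose l) * 3 ^ l / 2 ^ i) * (coord_X p ^ i * coord_b p ^ l))" for p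
    proof -
      have "fst p = coord_X p / 2" "snd p = ?w * (3 * coord_b p + 1)"
        using cartesian_from_coords[of p] by (metis fst_conv, metis snd_conv mult.commute mult_1 times_divide_eq_right)
      then have "fst p ^ i * snd p ^ j = (coord_X p / 2) ^ i * (?w ^ j * (3 * coord_b p + 1) ^ j)"
        by (simp only: power_mult_distrib)
      also have "(3 * coord_b p + 1) ^ j = (\<Sum>l\<le>j. of_nat (j choose l) * (3 * coord_b p) ^ l)"
        by (simp add: binomial_ring)
      finally show ?thesis
        by (simp add: sum_distrib_left power_mult_distrib power_divide mult_ac)
    qed
    ultimately show ?thesis by simp
  qed
  have "(\<lambda>p. \<Sum>i\<le>k. 1 * (\<Sum>j\<le>k - i. c i j * (fst p ^ i * snd p ^ j))) \<in> mode_span I"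
    by (rule mode_span_sum, simp, rule mode_span_sum, simp, rule mono) auto
  moreover have "f = (\<lambda>p. \<Sum>i\<le>k. 1 * (\<Sum>j\<le>k - i. c i j * (fst p ^ i * snd p ^ j)))"
    unfolding f by (auto simp: mult.assoc)
  ultimately show "f \<in> mode_span I" by simp
qed

lemma poly_space_3_subset_mode_span: "poly_space 3 \<subseteq> mode_span {..<10}"
proof (rule poly_space_subset_mode_spanI)
  fix i j :: nat assume "i + j \<le> 3"
  then have "i = 0 \<and> (j = 0 \<or> j = 1 \<or> j = 2 \<or> j = 3) \<or> i = 1 \<and> (j = 0 \<or> j = 1 \<or> j = 2)
      \<or> i = 2 \<and> (j = 0 \<or> j = 1) \<or> i = 3 \<and> j = 0"
    by presburger
  then show "(\<lambda>p. coord_X p ^ i * coord_b p ^ j) \<in> mode_span {..<10}"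
    using monomials_in_mode_span[of "{..<10}"] by auto
qed

lemma poly_space_2_subset_mode_span: "poly_space 2 \<subseteq> mode_span low_modes"
proof (rule poly_space_subset_mode_spanI)
  fix i j :: nat assume "i + j \<le> 2"
  then have "i = 0 \<and> (j = 0 \<or> j = 1 \<or> j = 2) \<or> i = 1 \<and> (j = 0 \<or> j = 1) \<or> i = 2 \<and> j = 0"
    by presburger
  then show "(\<lambda>p. coord_X p ^ i * coord_b p ^ j) \<in> mode_span low_modes"
    using monomials_in_mode_span[of low_modes] by auto
qed

section \<open>Integration over the reference triangle\<close>

lemma ref_triangle_eq:
  "ref_triangle = {p. - 1 / sqrt 3 \<le> snd p \<and> 3 * \<bar>fst p\<bar> \<le> 2 - sqrt 3 * snd p}"
proof (intro equalityI subsetI)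
  fix p assume "p \<in> ref_triangle"
  then obtain u v w where uvw: "u \<ge> 0" "v \<ge> 0" "w \<ge> 0" "u + v + w = 1"
    and p: "p = u *\<^sub>R vertex 0 + v *\<^sub>R vertex 1 + w *\<^sub>R vertex 2"
    unfolding ref_triangle_def convex_hull_3 by blast
  have u: "u = 1 - v - w" using uvw by simp
  have "fst p = 2 * v + w - 1" "snd p = (3 * w - 1) / sqrt 3"
    unfolding p vertex_def by (simp_all add: u field_simps)
  moreover have "- 1 / sqrt 3 \<le> (3 * w - 1) / sqrt 3"
    using uvw by (intro divide_right_mono) auto
  moreover have "\<bar>2 * v + w - 1\<bar> \<le> 1 - w"
    using uvw by linarith
  ultimately show "p \<in> {p. - 1 / sqrt 3 \<le> snd p \<and> 3 * \<bar>fst p\<bar> \<le> 2 - sqrt 3 * snd p}"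
    by simp
next
  fix p :: "real \<times> real"
  assume p: "p \<in> {p. - 1 / sqrt 3 \<le> snd p \<and> 3 * \<bar>fst p\<bar> \<le> 2 - sqrt 3 * snd p}"
  \<comment> \<open>u, v and w are the barycentric coordinates of p.\<close>
  define w where "w = (1 + sqrt 3 * snd p) / 3"
  define u where "u = (1 - w - fst p) / 2"
  define v where "v = (1 - w + fst p) / 2"
  have "- 1 \<le> sqrt 3 * snd p"
    using p by (auto simp: field_simps)
  then have "u \<ge> 0" "v \<ge> 0" "w \<ge> 0" "u + v + w = 1"
    using p unfolding u_def v_def w_def by (auto simp: field_simps abs_if split: if_splits)
  moreover have "p = u *\<^sub>R vertex 0 + v *\<^sub>R vertex 1 + w *\<^sub>R vertex 2"
    by (cases p) (simp add: vertex_def u_def v_def w_def field_simps)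
  ultimately show "p \<in> ref_triangle"
    unfolding ref_triangle_def convex_hull_3 by blast
qed

lemma compact_ref_triangle: "compact ref_triangle"
  unfolding ref_triangle_def by (intro compact_convex_hull finite_imp_compact) simp

lemma set_integrable_compact:
  fixes f :: "'a::euclidean_space \<Rightarrow> real"
  assumes "compact S" "continuous_on S f"
  shows "set_integrable lborel S f"
  unfolding set_integrable_def by (rule borel_integrable_compact[OF assms])

lemma integrable_on_ref_triangle:
  fixes f :: "real \<times> real \<Rightarrow> real"
  assumes "continuous_on UNIV f"
  shows "f integrable_on ref_triangle"
  using assms compact_ref_triangle continuous_on_subset
  by (blast intro: set_borel_integral_eq_integral set_integrable_compact)

(* B is an inner antiderivative along the horizontal line of half-length l, and A an outer one in l. *)
lemma integral_ref_triangle: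
  fixes f :: "real \<times> real \<Rightarrow> real"
  assumes f: "continuous_on UNIV f"
    and B: "\<And>l x. (B l has_real_derivative f (x, (2 - 3 * l) / sqrt 3)) (at x)"
    and A: "\<And>l. (A has_real_derivative B l l - B l (- l)) (at l)"
  shows "integral ref_triangle f = sqrt 3 * (A 1 - A 0)"
proof -
  define l where "l y = (2 - sqrt 3 * y) / 3" for y :: real
  define I where "I = {- 1 / sqrt 3 .. 2 / sqrt 3}"
  have l_pos: "l y \<ge> 0 \<longleftrightarrow> y \<le> 2 / sqrt 3" for y
    unfolding l_def by (simp add: field_simps)
  have y_l: "(2 - 3 * l y) / sqrt 3 = y" for y
    unfolding l_def by (simp add: field_simps)
  have ind: "indicator ref_triangle (x, y) = (indicator I y * indicator {- l y .. l y} x :: real)" for x y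
  proof -
    have "(x, y) \<in> ref_triangle \<longleftrightarrow> - 1 / sqrt 3 \<le> y \<and> \<bar>x\<bar> \<le> l y"
      unfolding ref_triangle_eq l_def by auto
    also have "\<dots> \<longleftrightarrow> y \<in> I \<and> x \<in> {- l y .. l y}"
      unfolding I_def using l_pos[of y] by auto
    finally show ?thesis by (simp add: indicator_def)
  qed
  have int: "set_integrable lborel ref_triangle f"
    using f compact_ref_triangle continuous_on_subset by (blast intro: set_integrable_compact)
  then have int': "integrable (lborel \<Otimes>\<^sub>M lborel) (\<lambda>(x, y). indicator ref_triangle (x, y) *\<^sub>R f (x, y))"
    unfolding set_integrable_def lborel_prod by (simp add: case_prod_beta')
  have inner: "(LINT x|lborel. indicator ref_triangle (x, y) *\<^sub>R f (x, y))
      = indicator I y * (B (l y) (l y) - B (l y) (- l y))" for y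
  proof (cases "y \<in> I")
    case True
    then have "- l y \<le> l y" using l_pos[of y] unfolding I_def by simp
    moreover have "(B (l y) has_vector_derivative f (x, y)) (at x within {- l y .. l y})" for x
      using B[of "l y" x] unfolding y_l
      by (simp add: has_real_derivative_iff_has_vector_derivative has_vector_derivative_at_within)
    ultimately have "((\<lambda>x. f (x, y)) has_integral (B (l y) (l y) - B (l y) (- l y))) {- l y .. l y}"
      by (intro fundamental_theorem_of_calculus)
    moreover have "continuous_on {- l y .. l y} (\<lambda>x. f (x, y))"
      by (rule continuous_on_compose2[OF f]) (auto intro!: continuous_intros)
    then have "set_integrable lborel {- l y .. l y} (\<lambda>x. f (x, y))"
      by (intro set_integrable_compact) auto
    ultimately have "(LINT x:{- l y .. l y}|lborel. f (x, y)) = B (l y) (l y) - B (l y) (- l y)"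
      by (simp add: set_borel_integral_eq_integral(2) integral_unique)
    with True show ?thesis
      unfolding set_lebesgue_integral_def ind by simp
  qed (simp add: ind)
  have outer_int: "set_integrable lborel I (\<lambda>y. B (l y) (l y) - B (l y) (- l y))"
    using lborel_pair.integrable_snd[OF int'] unfolding inner set_integrable_def by simp
  \<comment> \<open>The substitution from the height y to the half-length l has derivative - 1 /
    sqrt 3, which the factor - sqrt 3 compensates.\<close>
  have "((\<lambda>y. - sqrt 3 * A (l y)) has_vector_derivative B (l y) (l y) - B (l y) (- l y)) (at y within I)" for y
  proof -
    have "(l has_real_derivative - sqrt 3 / 3) (at y within I)"
      unfolding l_def by (auto intro!: derivative_eq_intros)
    then have "((\<lambda>y. A (l y)) has_real_derivative (B (l y) (l y) - B (l y) (- l y)) * (- sqrt 3 / 3)) (at y within I)"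
      using DERIV_chain2[OF A] by blast
    note DERIV_cmult[OF this, of "- sqrt 3"]
    moreover have "- sqrt 3 * (c * (- sqrt 3 / 3)) = c" for c :: real
      by simp
    ultimately show ?thesis
      by (simp only: has_real_derivative_iff_has_vector_derivative)
  qed
  moreover have "- 1 / sqrt 3 \<le> 2 / sqrt 3" by (intro divide_right_mono) auto
  ultimately have "((\<lambda>y. B (l y) (l y) - B (l y) (- l y)) has_integral
      (- sqrt 3 * A (l (2 / sqrt 3)) - (- sqrt 3 * A (l (- 1 / sqrt 3))))) I"
    unfolding I_def by (intro fundamental_theorem_of_calculus)
  \<comment> \<open>The chord shrinks to a point at the top vertex and has half-length 1 along the
    bottom edge.\<close>
  moreover have "l (2 / sqrt 3) = 0" "l (- 1 / sqrt 3) = 1"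
    unfolding l_def by simp_all
  ultimately have "integral I (\<lambda>y. B (l y) (l y) - B (l y) (- l y)) = sqrt 3 * (A 1 - A 0)"
    by (simp add: integral_unique algebra_simps)
  moreover have "integral ref_triangle f = (LINT p|lborel. indicator ref_triangle p *\<^sub>R f p)"
    using set_borel_integral_eq_integral(2)[OF int] unfolding set_lebesgue_integral_def by simp
  moreover have "\<dots> = (LINT y|lborel. LINT x|lborel. indicator ref_triangle (x, y) *\<^sub>R f (x, y))"
    using lborel_pair.integral_snd[OF int'] unfolding lborel_prod by (simp add: case_prod_beta')
  moreover have "\<dots> = integral I (\<lambda>y. B (l y) (l y) - B (l y) (- l y))"
    using set_borel_integral_eq_integral(2)[OF outer_int] unfolding inner set_lebesgue_integral_def by simp
  ultimately show ?thesis by simp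
qed

text \<open>The moments that arise when r^2 and x are paired with the divergences of the gradient
  field and of the horizontal field. Each \<open>?A\<close> is an antiderivative in l of the
  difference of \<open>B\<close> at l and - l.\<close>

lemma triangle_moments:
  "integral ref_triangle (\<lambda>p. fst p ^ 2) = sqrt 3 / 6"
  "integral ref_triangle (\<lambda>p. fst p ^ 2 + snd p ^ 2) = sqrt 3 / 3"
  "integral ref_triangle (\<lambda>p. fst p ^ 2 * snd p) = - 1 / 15"
  "integral ref_triangle (\<lambda>p. (fst p ^ 2 + snd p ^ 2) ^ 2) = 8 * sqrt 3 / 45"
proof -
  have sqrt_3_sqrt_3: "sqrt 3 * (sqrt 3 * z) = 3 * z" for z
    by (simp flip: mult.assoc)
  have "integral ref_triangle (\<lambda>p. fst p ^ 2) = sqrt 3 * (1 ^ 4 / 6 - 0 ^ 4 / 6)"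
    by (rule integral_ref_triangle[where B = "\<lambda>l x. x ^ 3 / 3"])
      (auto intro!: continuous_intros derivative_eq_intros)
  then show "integral ref_triangle (\<lambda>p. fst p ^ 2) = sqrt 3 / 6" by simp
  let ?A = "\<lambda>l::real. (5 * l ^ 4 - 8 * l ^ 3 + 4 * l ^ 2) / 3"
  have "integral ref_triangle (\<lambda>p. fst p ^ 2 + snd p ^ 2) = sqrt 3 * (?A 1 - ?A 0)"
    by (rule integral_ref_triangle[where B = "\<lambda>l x. x ^ 3 / 3 + (2 - 3 * l) ^ 2 * x / 3"])
      (auto intro!: continuous_intros derivative_eq_intros simp: power_divide field_simps power2_eq_square power3_eq_cube)
  then show "integral ref_triangle (\<lambda>p. fst p ^ 2 + snd p ^ 2) = sqrt 3 / 3" by simp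
  let ?A = "\<lambda>l::real. (l ^ 4 / 2 - 3 * l ^ 5 / 5) * 2 / (3 * sqrt 3)"
  have "integral ref_triangle (\<lambda>p. fst p ^ 2 * snd p) = sqrt 3 * (?A 1 - ?A 0)"
    by (rule integral_ref_triangle[where B = "\<lambda>l x. x ^ 3 * (2 - 3 * l) / (3 * sqrt 3)"])
      (auto intro!: continuous_intros derivative_eq_intros simp: field_simps eval_nat_numeral sqrt_3_sqrt_3)
  then show "integral ref_triangle (\<lambda>p. fst p ^ 2 * snd p) = - 1 / 15" by simp
  let ?A = "\<lambda>l::real. l ^ 6 / 15 + 4 / 9 * (l ^ 4 - 12 / 5 * l ^ 5 + 3 / 2 * l ^ 6)
      + 2 / 9 * (8 * l ^ 2 - 32 * l ^ 3 + 54 * l ^ 4 - 216 / 5 * l ^ 5 + 27 / 2 * l ^ 6)"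
  have "integral ref_triangle (\<lambda>p. (fst p ^ 2 + snd p ^ 2) ^ 2) = sqrt 3 * (?A 1 - ?A 0)"
    by (rule integral_ref_triangle[where B = "\<lambda>l x. x ^ 5 / 5 + 2 * (2 - 3 * l) ^ 2 * x ^ 3 / 9 + (2 - 3 * l) ^ 4 * x / 9"])
      (auto intro!: continuous_intros derivative_eq_intros simp: power_divide field_simps eval_nat_numeral)
  then show "integral ref_triangle (\<lambda>p. (fst p ^ 2 + snd p ^ 2) ^ 2) = 8 * sqrt 3 / 45" by simp
qed

section \<open>The mass matrix\<close>

lemma continuous_dubiner_3:
  assumes "m < 10"
  shows "continuous_on S (dubiner 3 (m + 1))"
proof -
  have "m \<in> {..<10}" using assms by simp
  then have "continuous_on S (\<lambda>p. mode_const m * shape m (coord_X p) (coord_b p))"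
    unfolding lessThan_10 insert_iff empty_iff
    by (elim disjE) (simp_all add: shape_def coord_X_def coord_b_def, (intro continuous_intros; simp)+)
  moreover have "dubiner 3 (m + 1) = (\<lambda>p. mode_const m * shape m (coord_X p) (coord_b p))"
    using dubiner_coords[OF assms] by blast
  ultimately show ?thesis by simp
qed

text \<open>On a box with interior, a nonnegative continuous function with integral 0 is zero
  pointwise. This box fits into the triangle, its upper right corner being the midpoint of the right
  edge, and contains the ten lattice points of \<open>shape_independent\<close>.\<close>

definition inner_box :: "(real \<times> real) set" where
  "inner_box = cbox (0, - 1 / sqrt 3) (1 / 2, 1 / (2 * sqrt 3))"

lemma inner_box_subset: "inner_box \<subseteq> ref_triangle"
proof
  fix p assume "p \<in> inner_box"
  then have p: "0 \<le> fst p" "fst p \<le> 1 / 2" "- 1 / sqrt 3 \<le> snd p" "snd p \<le> 1 / (2 * sqrt 3)"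
    by (cases p; auto simp: inner_box_def cbox_Pair_eq)+
  from p(4) have "sqrt 3 * snd p \<le> 1 / 2"
    by (simp add: field_simps)
  with p show "p \<in> ref_triangle"
    unfolding ref_triangle_eq by auto
qed

lemma integral_square_zero:
  assumes f: "continuous_on UNIV f" and zero: "integral ref_triangle (\<lambda>p. (f p)\<^sup>2) = 0"
  shows "\<forall>p\<in>inner_box. f p = (0 :: real)"
proof -
  have cont: "continuous_on S (\<lambda>p. (f p)\<^sup>2)" for S
    by (intro continuous_intros continuous_on_subset[OF f]) simp
  have int: "(\<lambda>p. (f p)\<^sup>2) integrable_on inner_box"
    unfolding inner_box_def by (rule integrable_continuous[OF cont])
  have "integral inner_box (\<lambda>p. (f p)\<^sup>2) \<le> integral ref_triangle (\<lambda>p. (f p)\<^sup>2)"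
    by (rule integral_subset_le[OF inner_box_subset int integrable_on_ref_triangle[OF cont]]) simp
  moreover have "integral inner_box (\<lambda>p. (f p)\<^sup>2) \<ge> 0"
    by (rule integral_nonneg[OF int]) simp
  ultimately have "integral inner_box (\<lambda>p. (f p)\<^sup>2) = 0"
    using zero by linarith
  moreover have "- 1 / sqrt 3 < 1 / (2 * sqrt 3)"
    by (simp add: field_simps)
  then have "box (0, - 1 / sqrt 3) (1 / 2 :: real, 1 / (2 * sqrt 3)) \<noteq> {}"
    by (simp add: box_ne_empty Basis_prod_def)
  note integral_cbox_eq_0_iff[OF cont this]
  ultimately have "\<forall>p\<in>inner_box. (f p)\<^sup>2 = 0"
    unfolding inner_box_def by simp
  then show ?thesis by simp
qed

lemma dubiner_3_independent:
  assumes "\<forall>p\<in>inner_box. (\<Sum>m<10. a m * dubiner 3 (m + 1) p) = 0"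
  shows "\<forall>m<10. a m = 0"
proof -
  have "(\<Sum>m<10. (a m * mode_const m) * shape m (real i / 4) (real j / 4 - 1)) = 0" if ij: "i + j \<le> 3" for i j
  proof -
    \<comment> \<open>Cartesian position of the lattice point with X = i / 4 and b = j / 4 -
      1.\<close>
    define p where "p = ((real i / 4) / 2, (3 * (real j / 4 - 1) + 1) / (2 * sqrt 3))"
    have "- 2 / (2 * sqrt 3) \<le> (3 * (real j / 4 - 1) + 1) / (2 * sqrt 3)"
      "(3 * (real j / 4 - 1) + 1) / (2 * sqrt 3) \<le> 1 / (2 * sqrt 3)"
      using ij by (intro divide_right_mono; simp)+
    then have "p \<in> inner_box"
      using ij unfolding p_def inner_box_def by (simp add: cbox_Pair_eq)
    then have "(\<Sum>m<10. a m * dubiner 3 (m + 1) p) = 0"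
      using assms by blast
    moreover have "(\<Sum>m<10. a m * dubiner 3 (m + 1) p)
        = (\<Sum>m<10. a m * mode_const m * shape m (real i / 4) (real j / 4 - 1))"
    proof (rule sum.cong)
      fix m :: nat assume "m \<in> {..<10}"
      then show "a m * dubiner 3 (m + 1) p = a m * mode_const m * shape m (real i / 4) (real j / 4 - 1)"
        unfolding p_def by (subst dubiner_shape) auto
    qed simp
    ultimately show ?thesis
      by simp
  qed
  then have "\<forall>m<10. a m * mode_const m = 0"
    by (rule shape_independent)
  then show ?thesis
    using mode_const_nz by simp
qed

lemma mass_matrix_carrier: "mass_matrix 3 \<in> carrier_mat 10 10"
  by (simp add: mass_matrix_def num_modes_def)

text \<open>M acts as a Gram matrix: a row of M applied to the coefficients of f is the L2 product
  of f with a mode.\<close>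

lemma mass_matrix_mult_vec:
  assumes a: "a \<in> carrier_vec 10" and m: "m < 10"
    and f: "\<And>p. f p = (\<Sum>n<10. a $ n * dubiner 3 (n + 1) p)"
  shows "(mass_matrix 3 *\<^sub>v a) $ m = integral ref_triangle (\<lambda>p. dubiner 3 (m + 1) p * f p)"
proof -
  let ?d = "\<lambda>m. dubiner 3 (m + 1)"
  have "(mass_matrix 3 *\<^sub>v a) $ m = (\<Sum>n<10. integral ref_triangle (\<lambda>p. ?d m p * ?d n p) * a $ n)"
    using a m by (simp add: mass_matrix_def num_modes_def scalar_prod_def atLeast0LessThan)
  also have "\<dots> = (\<Sum>n<10. integral ref_triangle (\<lambda>p. a $ n * (?d m p * ?d n p)))"
    by (simp add: mult.commute)
  also have "\<dots> = integral ref_triangle (\<lambda>p. \<Sum>n<10. a $ n * (?d m p * ?d n p))"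
    using m by (intro integral_sum[symmetric] integrable_on_ref_triangle continuous_intros continuous_dubiner_3) simp_all
  also have "\<dots> = integral ref_triangle (\<lambda>p. ?d m p * f p)"
    unfolding f by (simp add: sum_distrib_left mult_ac)
  finally show ?thesis .
qed

text \<open>The quadratic form at a is the integral of f^2 for the polynomial f with coefficients a,
  and independence of the modes makes it vanish only at a = 0. The inverse in \<open>C_DG\<close> is
  therefore a genuine one.\<close>

lemma mass_matrix_positive_definite: "positive_definite 10 (mass_matrix 3)"
  unfolding positive_definite_def
proof (intro conjI ballI impI)
  show "mass_matrix 3 \<in> carrier_mat 10 10"
    by (rule mass_matrix_carrier)
  show "transpose_mat (mass_matrix 3) = mass_matrix 3"
    by (rule eq_matI) (auto simp: mass_matrix_def mult.commute)
  fix a :: "real Matrix.vec" assume a: "a \<in> carrier_vec 10" and nz: "a \<noteq> 0\<^sub>v 10"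
  define f where "f p = (\<Sum>n<10. a $ n * dubiner 3 (n + 1) p)" for p
  have cont: "continuous_on S f" for S
    unfolding f_def by (intro continuous_intros continuous_dubiner_3) simp
  have "scalar_prod a (mass_matrix 3 *\<^sub>v a)
      = (\<Sum>m<10. a $ m * integral ref_triangle (\<lambda>p. dubiner 3 (m + 1) p * f p))"
    using mass_matrix_carrier mass_matrix_mult_vec[OF a _ f_def]
    by (simp add: scalar_prod_def atLeast0LessThan del: index_mult_mat_vec)
  also have "\<dots> = (\<Sum>m<10. integral ref_triangle (\<lambda>p. a $ m * (dubiner 3 (m + 1) p * f p)))"
    by simp
  also have "\<dots> = integral ref_triangle (\<lambda>p. \<Sum>m<10. a $ m * (dubiner 3 (m + 1) p * f p))"
    by (intro integral_sum[symmetric] integrable_on_ref_triangle continuous_intros continuous_dubiner_3 cont) simp_all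
  also have "\<dots> = integral ref_triangle (\<lambda>p. (f p)\<^sup>2)"
    by (simp add: f_def power2_eq_square sum_distrib_right mult_ac)
  finally have eq: "scalar_prod a (mass_matrix 3 *\<^sub>v a) = integral ref_triangle (\<lambda>p. (f p)\<^sup>2)" .
  moreover have "integral ref_triangle (\<lambda>p. (f p)\<^sup>2) \<ge> 0"
    by (intro integral_nonneg integrable_on_ref_triangle continuous_intros cont) simp
  moreover have "integral ref_triangle (\<lambda>p. (f p)\<^sup>2) \<noteq> 0"
  proof
    assume "integral ref_triangle (\<lambda>p. (f p)\<^sup>2) = 0"
    then have "\<forall>m<10. a $ m = 0"
      using integral_square_zero[OF cont] dubiner_3_independent[of "vec_index a"] unfolding f_def by blast
    with a nz show False
      by (auto intro!: eq_vecI)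
  qed
  ultimately show "scalar_prod a (mass_matrix 3 *\<^sub>v a) > 0"
    by simp
qed

text \<open>A positive definite matrix has trivial kernel, so \<open>mat_inverse\<close> returns
  \<open>Some\<close> and \<open>the\<close> is meaningful.\<close>

lemma positive_definite_inverse:
  assumes "positive_definite n A"
  shows "the (mat_inverse A) \<in> carrier_mat n n" "A * the (mat_inverse A) = 1\<^sub>m n"
proof -
  have A: "A \<in> carrier_mat n n"
    using assms unfolding positive_definite_def by simp
  have "Determinant.det A \<noteq> 0"
  proof
    assume "Determinant.det A = 0"
    then obtain v where "v \<in> carrier_vec n" "v \<noteq> 0\<^sub>v n" "A *\<^sub>v v = 0\<^sub>v n"
      using det_0_iff_vec_prod_zero_field[OF A] by blast
    then show False
      using assms unfolding positive_definite_def by fastforce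
  qed
  then obtain B where "mat_inverse A = Some B"
    using mat_inverse(1)[OF A, of "()"] det_non_zero_imp_unit[OF A, of "()"]
    by (cases "mat_inverse A") auto
  with mat_inverse(2)[OF A this]
  show "the (mat_inverse A) \<in> carrier_mat n n" "A * the (mat_inverse A) = 1\<^sub>m n"
    by simp_all
qed

section \<open>Coefficients with respect to the modes\<close>

lemma modal_coeffs_unique:
  assumes "a \<in> carrier_vec 10" "\<And>p. f p = (\<Sum>m<10. a $ m * dubiner 3 (m + 1) p)"
  shows "modal_coeffs 3 f = a"
  unfolding modal_coeffs_def
proof (rule the_equality)
  fix b :: "real Matrix.vec"
  assume b: "b \<in> carrier_vec (num_modes 3) \<and> (\<forall>p. f p = (\<Sum>m<num_modes 3. b $ m * dubiner 3 (m + 1) p))"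
  have n: "num_modes 3 = 10" by (simp add: num_modes_def)
  have "(\<Sum>m<10. (b $ m - a $ m) * dubiner 3 (m + 1) p) = 0" for p
    using assms(2)[of p] b unfolding n by (simp add: left_diff_distrib sum_subtractf)
  then have "\<forall>m<10. b $ m - a $ m = 0"
    by (intro dubiner_3_independent) simp
  with assms b show "b = a"
    unfolding n by (auto intro!: eq_vecI)
qed (use assms in \<open>simp add: num_modes_def\<close>)

lemma modal_coeffs_mode_span:
  assumes "f \<in> mode_span {..<10}"
  shows "modal_coeffs 3 f \<in> carrier_vec 10"
    "f p = (\<Sum>m<10. modal_coeffs 3 f $ m * dubiner 3 (m + 1) p)"
proof -
  obtain a where a: "\<And>p. f p = (\<Sum>m<10. a m * dubiner 3 (m + 1) p)"
    using assms unfolding mode_span_def by blast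
  have "modal_coeffs 3 f = Matrix.vec 10 a"
    by (rule modal_coeffs_unique) (auto simp: a)
  with a show "modal_coeffs 3 f \<in> carrier_vec 10"
    "f p = (\<Sum>m<10. modal_coeffs 3 f $ m * dubiner 3 (m + 1) p)"
    by auto
qed

section \<open>Polynomial and Raviart-Thomas spaces\<close>

lemma poly_spaceI:
  assumes "\<And>p. f p = (\<Sum>i\<le>k. \<Sum>j\<le>k - i. c i j * (fst p ^ i * snd p ^ j))"
  shows "f \<in> poly_space k"
proof -
  have "f = (\<lambda>(x, y). \<Sum>i\<le>k. \<Sum>j\<le>k - i. c i j * x ^ i * y ^ j)"
    by (rule ext) (simp add: assms case_prod_beta mult.assoc)
  then show ?thesis
    unfolding poly_space_def by blast
qed

lemma poly_spaceE:
  assumes "f \<in> poly_space k"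
  obtains c where "\<And>p. f p = (\<Sum>i\<le>k. \<Sum>j\<le>k - i. c i j * (fst p ^ i * snd p ^ j))"
proof -
  obtain c where "f = (\<lambda>(x, y). \<Sum>i\<le>k. \<Sum>j\<le>k - i. c i j * x ^ i * y ^ j)"
    using assms unfolding poly_space_def by blast
  then have "f p = (\<Sum>i\<le>k. \<Sum>j\<le>k - i. c i j * (fst p ^ i * snd p ^ j))" for p
    by (simp add: case_prod_beta mult.assoc)
  then show ?thesis by (rule that)
qed

lemma poly_space_monomial:
  assumes "i + j \<le> k"
  shows "(\<lambda>p. fst p ^ i * snd p ^ j) \<in> poly_space k"
proof (rule poly_spaceI)
  fix p :: "real \<times> real"
  have "(\<Sum>i'\<le>k. \<Sum>j'\<le>k - i'. (if i' = i \<and> j' = j then 1 else 0) * (fst p ^ i' * snd p ^ j'))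
      = (\<Sum>i'\<le>k. if i' = i then fst p ^ i * snd p ^ j else 0)"
  proof (rule sum.cong)
    fix i' assume "i' \<in> {..k}"
    show "(\<Sum>j'\<le>k - i'. (if i' = i \<and> j' = j then 1 else 0) * (fst p ^ i' * snd p ^ j'))
        = (if i' = i then fst p ^ i * snd p ^ j else 0)"
    proof (cases "i' = i")
      case True
      then have "(\<Sum>j'\<le>k - i'. (if i' = i \<and> j' = j then 1 else 0) * (fst p ^ i' * snd p ^ j'))
          = (\<Sum>j'\<le>k - i'. if j' = j then fst p ^ i * snd p ^ j else 0)"
        by (intro sum.cong) auto
      with True assms show ?thesis by simp
    qed simp
  qed simp
  also have "\<dots> = fst p ^ i * snd p ^ j"
    using assms by simp
  finally show "fst p ^ i * snd p ^ j
      = (\<Sum>i'\<le>k. \<Sum>j'\<le>k - i'. (if i' = i \<and> j' = j then 1 else 0) * (fst p ^ i' * snd p ^ j'))" ..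
qed

lemma poly_space_lincomb:
  assumes "f \<in> poly_space k" "g \<in> poly_space k"
  shows "(\<lambda>p. \<alpha> * f p + \<beta> * g p) \<in> poly_space k"
proof -
  obtain c where f: "\<And>p. f p = (\<Sum>i\<le>k. \<Sum>j\<le>k - i. c i j * (fst p ^ i * snd p ^ j))"
    using poly_spaceE[OF assms(1)] by blast
  obtain d where g: "\<And>p. g p = (\<Sum>i\<le>k. \<Sum>j\<le>k - i. d i j * (fst p ^ i * snd p ^ j))"
    using poly_spaceE[OF assms(2)] by blast
  show ?thesis
    by (rule poly_spaceI[where c = "\<lambda>i j. \<alpha> * c i j + \<beta> * d i j"])
      (simp add: f g sum_distrib_left sum.distrib algebra_simps)
qed

lemma poly_space_const: "(\<lambda>p. c) \<in> poly_space k"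
  using poly_space_lincomb[OF poly_space_monomial[of 0 0 k] poly_space_monomial[of 0 0 k], of c 0] by simp

lemma poly_space_cmult: "f \<in> poly_space k \<Longrightarrow> (\<lambda>p. c * f p) \<in> poly_space k"
  using poly_space_lincomb[of f k f c 0] by simp

lemma poly_space_add: "f \<in> poly_space k \<Longrightarrow> g \<in> poly_space k \<Longrightarrow> (\<lambda>p. f p + g p) \<in> poly_space k"
  using poly_space_lincomb[of f k g 1 1] by simp

lemma poly_space_sum:
  assumes "finite A" "\<And>l. l \<in> A \<Longrightarrow> f l \<in> poly_space k"
  shows "(\<lambda>p. \<Sum>l\<in>A. f l p) \<in> poly_space k"
  using assms by (induction A rule: finite_induct) (auto simp: poly_space_const poly_space_add)

lemma poly_space_mult:
  assumes "f \<in> poly_space k" "g \<in> poly_space l"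
  shows "(\<lambda>p. f p * g p) \<in> poly_space (k + l)"
proof -
  obtain c where f: "\<And>p. f p = (\<Sum>i\<le>k. \<Sum>j\<le>k - i. c i j * (fst p ^ i * snd p ^ j))"
    using poly_spaceE[OF assms(1)] by blast
  obtain d where g: "\<And>p. g p = (\<Sum>i\<le>l. \<Sum>j\<le>l - i. d i j * (fst p ^ i * snd p ^ j))"
    using poly_spaceE[OF assms(2)] by blast
  have mono: "(\<lambda>p. c i j * d i' j' * (fst p ^ (i + i') * snd p ^ (j + j'))) \<in> poly_space (k + l)"
    if "i \<le> k" "j \<le> k - i" "i' \<le> l" "j' \<le> l - i'" for i j i' j'
    using that by (intro poly_space_cmult poly_space_monomial) auto
  have "(\<lambda>p. \<Sum>i\<le>k. \<Sum>j\<le>k - i. \<Sum>i'\<le>l. \<Sum>j'\<le>l - i'.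
      c i j * d i' j' * (fst p ^ (i + i') * snd p ^ (j + j'))) \<in> poly_space (k + l)"
    by (intro poly_space_sum mono) auto
  moreover have "f p * g p = (\<Sum>i\<le>k. \<Sum>j\<le>k - i. \<Sum>i'\<le>l. \<Sum>j'\<le>l - i'.
      c i j * d i' j' * (fst p ^ (i + i') * snd p ^ (j + j')))" for p
  proof -
    have "f p * g p = (\<Sum>i\<le>k. \<Sum>j\<le>k - i. c i j * (fst p ^ i * snd p ^ j) * g p)"
      by (simp only: f sum_distrib_right)
    then show ?thesis
      by (simp add: g sum_distrib_left power_add mult_ac)
  qed
  ultimately show ?thesis by simp
qed

lemma poly_space_power:
  assumes "f \<in> poly_space k"
  shows "(\<lambda>p. f p ^ n) \<in> poly_space (n * k)"
  using assms by (induction n) (auto simp: poly_space_const poly_space_mult)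

lemma poly_space_mono:
  assumes "k \<le> l"
  shows "poly_space k \<subseteq> poly_space l"
proof
  fix f assume "f \<in> poly_space k"
  from poly_space_mult[OF this poly_space_const[of 1 "l - k"]] assms show "f \<in> poly_space l"
    by simp
qed

lemma poly_space_poly_compose:
  assumes "f \<in> poly_space 1" "Polynomial.degree q \<le> w"
  shows "(\<lambda>p. poly q (f p)) \<in> poly_space w"
proof -
  have "(\<lambda>p. \<Sum>i\<le>Polynomial.degree q. Polynomial.coeff q i * f p ^ i) \<in> poly_space w"
  proof (intro poly_space_sum poly_space_cmult finite_atMost)
    fix i assume "i \<in> {..Polynomial.degree q}"
    then show "(\<lambda>p. f p ^ i) \<in> poly_space w"
      using poly_space_power[OF assms(1), of i] poly_space_mono[of i w] assms(2) by auto
  qed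
  then show ?thesis by (simp add: poly_altdef)
qed

lemma poly_space_affine: "(\<lambda>p. \<alpha> * fst p + \<beta> * snd p + \<gamma>) \<in> poly_space 1"
proof -
  have "fst \<in> poly_space 1" "snd \<in> poly_space 1"
    using poly_space_monomial[of 1 0 1] poly_space_monomial[of 0 1 1] by simp_all
  then show ?thesis
    by (intro poly_space_add poly_space_const poly_space_cmult)
qed

lemma dubiner_vw_in_poly_space: "dubiner_vw v w \<in> poly_space (v + w)"
proof -
  have b: "coord_b \<in> poly_space 1"
    using poly_space_affine[of 0 "2 * sqrt 3 / 3" "- 1 / 3"] by (simp add: coord_b_def[abs_def] diff_divide_distrib)
  have x: "coord_X \<in> poly_space 1"
    using poly_space_affine[of 2 0 0] by (simp add: coord_X_def[abs_def])
  have "(\<lambda>p. 1 + - 1 * coord_b p) \<in> poly_space 1"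
    by (intro poly_space_add poly_space_const poly_space_cmult b)
  then have c: "(\<lambda>p. 1 - coord_b p) \<in> poly_space 1"
    by simp
  have "(\<lambda>p. coord_X p ^ j * (1 - coord_b p) ^ (v - j)) \<in> poly_space v" if "j \<le> v" for j
    using poly_space_mult[OF poly_space_power[OF x, of j] poly_space_power[OF c, of "v - j"]] that by simp
  then have "(\<lambda>p. \<Sum>j\<le>v. Polynomial.coeff (jacobi_normalized 0 0 v) j * (coord_X p ^ j * (1 - coord_b p) ^ (v - j)))
      \<in> poly_space v"
    by (intro poly_space_sum poly_space_cmult) auto
  moreover have "(\<lambda>p. poly (jacobi_normalized (2 * v + 1) 0 w) (coord_b p)) \<in> poly_space w"
    using degree_jacobi by (intro poly_space_poly_compose b) (simp add: jacobi_normalized_eq degree_smult_eq jac_norm_nz)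
  ultimately have "(\<lambda>p. 2 / root 4 3 * ((\<Sum>j\<le>v. Polynomial.coeff (jacobi_normalized 0 0 v) j * (coord_X p ^ j * (1 - coord_b p) ^ (v - j)))
      * poly (jacobi_normalized (2 * v + 1) 0 w) (coord_b p))) \<in> poly_space (v + w)"
    by (intro poly_space_cmult poly_space_mult)
  moreover have "dubiner_vw v w = (\<lambda>p. 2 / root 4 3 * ((\<Sum>j\<le>v. Polynomial.coeff (jacobi_normalized 0 0 v) j * (coord_X p ^ j * (1 - coord_b p) ^ (v - j)))
      * poly (jacobi_normalized (2 * v + 1) 0 w) (coord_b p)))"
    by (rule ext) (simp add: dubiner_vw_def Let_def coord_X_def coord_b_def case_prod_beta mult.assoc)
  ultimately show ?thesis by simp
qed

text \<open>The last claim is the important one: the Euler operator x d/dx + y d/dy multiplies each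
  monomial by its degree and so raises no degree. It keeps the divergence of (x r, y r) within
  degree k although the components may have degree k + 1.\<close>

lemma poly_space_partial_derivatives:
  assumes "f \<in> poly_space k"
  obtains fx fy where
    "\<And>x y. ((\<lambda>x. f (x, y)) has_real_derivative fx (x, y)) (at x)"
    "\<And>x y. ((\<lambda>y. f (x, y)) has_real_derivative fy (x, y)) (at y)"
    "fx \<in> poly_space k" "fy \<in> poly_space k" "(\<lambda>p. fst p * fx p + snd p * fy p) \<in> poly_space k"
proof -
  obtain c where f: "\<And>p. f p = (\<Sum>i\<le>k. \<Sum>j\<le>k - i. c i j * (fst p ^ i * snd p ^ j))"
    using poly_spaceE[OF assms] by blast
  define fx where "fx p = (\<Sum>i\<le>k. \<Sum>j\<le>k - i. c i j * real i * (fst p ^ (i - 1) * snd p ^ j))" for p :: "real \<times> real"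
  define fy where "fy p = (\<Sum>i\<le>k. \<Sum>j\<le>k - i. c i j * real j * (fst p ^ i * snd p ^ (j - 1)))" for p :: "real \<times> real"
  have "((\<lambda>x. f (x, y)) has_real_derivative fx (x, y)) (at x)" for x y
    unfolding f fx_def by (auto intro!: derivative_eq_intros sum.cong simp: mult_ac)
  moreover have "((\<lambda>y. f (x, y)) has_real_derivative fy (x, y)) (at y)" for x y
    unfolding f fy_def by (auto intro!: derivative_eq_intros sum.cong simp: mult_ac)
  moreover have "fx \<in> poly_space k"
    unfolding fx_def by (intro poly_space_sum poly_space_cmult poly_space_monomial) auto
  moreover have "fy \<in> poly_space k"
    unfolding fy_def by (intro poly_space_sum poly_space_cmult poly_space_monomial) auto
  moreover have "fst p * fx p + snd p * fy p = (\<Sum>i\<le>k. \<Sum>j\<le>k - i. c i j * real (i + j) * (fst p ^ i * snd p ^ j))" for p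
  proof -
    \<comment> \<open>For i = 0 the exponent i - 1 is truncated to 0, and the factor i makes the
      term vanish.\<close>
    have pow: "x * (d * real i * (x ^ (i - 1) * z)) = d * real i * (x ^ i * z)"
      "x * (d * real i * (z * x ^ (i - 1))) = d * real i * (z * x ^ i)" for x d z :: real and i
      by (cases i; simp)+
    show ?thesis
      unfolding fx_def fy_def sum_distrib_left pow sum.distrib[symmetric]
      by (simp add: algebra_simps)
  qed
  then have "(\<lambda>p. fst p * fx p + snd p * fy p) \<in> poly_space k"
    by (rule poly_spaceI)
  ultimately show ?thesis by (rule that)
qed

section \<open>The Raviart-Thomas space and its divergence\<close>

lemma RT_spaceE:
  assumes "h \<in> RT_space k"
  obtains f g r where "f \<in> poly_space k" "g \<in> poly_space k" "r \<in> poly_space k"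
    "\<And>p. h p = (f p + fst p * r p, g p + snd p * r p)"
proof -
  obtain f g c where fg: "f \<in> poly_space k" "g \<in> poly_space k"
    and h: "h = (\<lambda>(x, y). let r = (\<Sum>v\<le>k. c v * dubiner_vw v (k - v) (x, y)) in
                     (f (x, y) + x * r, g (x, y) + y * r))"
    using assms unfolding RT_space_def by blast
  have "(\<lambda>p. \<Sum>v\<le>k. c v * dubiner_vw v (k - v) p) \<in> poly_space k"
  proof (intro poly_space_sum poly_space_cmult finite_atMost)
    fix v assume "v \<in> {..k}"
    then show "dubiner_vw v (k - v) \<in> poly_space k"
      using dubiner_vw_in_poly_space[of v "k - v"] by simp
  qed
  then show ?thesis
    by (rule that[OF fg]) (simp add: h Let_def case_prod_beta)
qed

text \<open>For h = (f + x r, g + y r) the divergence is f_x + g_y + 2 r + (x r_x + y r_y), and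
  every term has degree at most k.\<close>

lemma RT_space_divergence:
  assumes "h \<in> RT_space k"
  obtains hx hy where
    "\<And>x y. ((\<lambda>x. fst (h (x, y))) has_real_derivative hx (x, y)) (at x)"
    "\<And>x y. ((\<lambda>y. snd (h (x, y))) has_real_derivative hy (x, y)) (at y)"
    "(\<lambda>p. hx p + hy p) \<in> poly_space k"
proof -
  obtain f g r where fgr: "f \<in> poly_space k" "g \<in> poly_space k" "r \<in> poly_space k"
    and h: "\<And>p. h p = (f p + fst p * r p, g p + snd p * r p)"
    by (rule RT_spaceE[OF assms]) (rule that)
  obtain fx where fx: "\<And>x y. ((\<lambda>x. f (x, y)) has_real_derivative fx (x, y)) (at x)" "fx \<in> poly_space k"
    by (rule poly_space_partial_derivatives[OF fgr(1)]) (rule that)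
  obtain gy where gy: "\<And>x y. ((\<lambda>y. g (x, y)) has_real_derivative gy (x, y)) (at y)" "gy \<in> poly_space k"
    by (rule poly_space_partial_derivatives[OF fgr(2)]) (rule that)
  obtain rx ry where rx: "\<And>x y. ((\<lambda>x. r (x, y)) has_real_derivative rx (x, y)) (at x)"
    and ry: "\<And>x y. ((\<lambda>y. r (x, y)) has_real_derivative ry (x, y)) (at y)"
    and euler: "(\<lambda>p. fst p * rx p + snd p * ry p) \<in> poly_space k"
    by (rule poly_space_partial_derivatives[OF fgr(3)]) (rule that)
  define hx where "hx p = fx p + (r p + fst p * rx p)" for p
  define hy where "hy p = gy p + (r p + snd p * ry p)" for p
  have "((\<lambda>x. fst (h (x, y))) has_real_derivative hx (x, y)) (at x)" for x y
    unfolding h hx_def by (auto intro!: derivative_eq_intros fx rx)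
  moreover have "((\<lambda>y. snd (h (x, y))) has_real_derivative hy (x, y)) (at y)" for x y
    unfolding h hy_def by (auto intro!: derivative_eq_intros gy ry)
  moreover have "(\<lambda>p. (fx p + gy p) + (2 * r p + (fst p * rx p + snd p * ry p))) \<in> poly_space k"
    by (intro poly_space_add poly_space_cmult fx gy fgr euler)
  then have "(\<lambda>p. hx p + hy p) \<in> poly_space k"
    by (simp add: hx_def hy_def algebra_simps)
  ultimately show ?thesis by (rule that)
qed

lemma divergence_eqI:
  assumes "\<And>x y. ((\<lambda>x. fst (h (x, y))) has_real_derivative hx (x, y)) (at x)"
    "\<And>x y. ((\<lambda>y. snd (h (x, y))) has_real_derivative hy (x, y)) (at y)"
  shows "divergence h p = hx p + hy p"
  by (cases p) (simp add: divergence_def DERIV_imp_deriv[OF assms(1)] DERIV_imp_deriv[OF assms(2)])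

lemma divergence_in_poly_space:
  assumes "h \<in> RT_space k"
  shows "divergence h \<in> poly_space k"
proof -
  obtain hx hy where h: "\<And>x y. ((\<lambda>x. fst (h (x, y))) has_real_derivative hx (x, y)) (at x)"
    "\<And>x y. ((\<lambda>y. snd (h (x, y))) has_real_derivative hy (x, y)) (at y)"
    and p: "(\<lambda>p. hx p + hy p) \<in> poly_space k"
    by (rule RT_space_divergence[OF assms]) (rule that)
  have "divergence h = (\<lambda>p. hx p + hy p)"
    by (rule ext) (rule divergence_eqI[OF h])
  with p show ?thesis by simp
qed

lemma divergence_add_scaled:
  assumes "h \<in> RT_space k" "h' \<in> RT_space k"
  shows "divergence (\<lambda>p. a *\<^sub>R h p + h' p) p = a * divergence h p + divergence h' p"
proof -
  obtain hx hy where h: "\<And>x y. ((\<lambda>x. fst (h (x, y))) has_real_derivative hx (x, y)) (at x)"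
    "\<And>x y. ((\<lambda>y. snd (h (x, y))) has_real_derivative hy (x, y)) (at y)"
    by (rule RT_space_divergence[OF assms(1)]) (rule that)
  obtain hx' hy' where h': "\<And>x y. ((\<lambda>x. fst (h' (x, y))) has_real_derivative hx' (x, y)) (at x)"
    "\<And>x y. ((\<lambda>y. snd (h' (x, y))) has_real_derivative hy' (x, y)) (at y)"
    by (rule RT_space_divergence[OF assms(2)]) (rule that)
  have "divergence (\<lambda>p. a *\<^sub>R h p + h' p) p = (a * hx p + hx' p) + (a * hy p + hy' p)"
    by (rule divergence_eqI; unfold fst_add snd_add fst_scaleR snd_scaleR real_scaleR_def;
        intro DERIV_add DERIV_cmult h h')
  then show ?thesis
    by (simp add: divergence_eqI[OF h] divergence_eqI[OF h'] algebra_simps)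
qed

lemma RT_space_pairI:
  assumes "f \<in> poly_space k" "g \<in> poly_space k"
  shows "(\<lambda>p. (f p, g p)) \<in> RT_space k"
  unfolding RT_space_def mem_Collect_eq
  by (rule bexI[OF _ assms(1)], rule bexI[OF _ assms(2)], rule exI[of _ "\<lambda>v. 0"]) auto

lemma RT_space_add_scaled:
  assumes "h \<in> RT_space k" "h' \<in> RT_space k"
  shows "(\<lambda>p. a *\<^sub>R h p + h' p) \<in> RT_space k"
proof -
  obtain f g c f' g' c' where fg: "f \<in> poly_space k" "g \<in> poly_space k" "f' \<in> poly_space k" "g' \<in> poly_space k"
    and h: "h = (\<lambda>(x, y). let r = (\<Sum>v\<le>k. c v * dubiner_vw v (k - v) (x, y)) in
                     (f (x, y) + x * r, g (x, y) + y * r))"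
    and h': "h' = (\<lambda>(x, y). let r = (\<Sum>v\<le>k. c' v * dubiner_vw v (k - v) (x, y)) in
                     (f' (x, y) + x * r, g' (x, y) + y * r))"
    using assms unfolding RT_space_def by blast
  have "(\<Sum>v\<le>k. (a * c v + c' v) * dubiner_vw v (k - v) p)
      = a * (\<Sum>v\<le>k. c v * dubiner_vw v (k - v) p) + (\<Sum>v\<le>k. c' v * dubiner_vw v (k - v) p)" for p
    by (simp add: sum_distrib_left sum.distrib algebra_simps)
  then have "(\<lambda>p. a *\<^sub>R h p + h' p) = (\<lambda>(x, y). let r = (\<Sum>v\<le>k. (a * c v + c' v) * dubiner_vw v (k - v) (x, y)) in
                     (a * f (x, y) + f' (x, y) + x * r, a * g (x, y) + g' (x, y) + y * r))"
    by (auto simp: h h' Let_def algebra_simps)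
  moreover have "(\<lambda>p. a * f p + f' p) \<in> poly_space k" "(\<lambda>p. a * g p + g' p) \<in> poly_space k"
    by (intro poly_space_add poly_space_cmult fg)+
  ultimately show ?thesis
    unfolding RT_space_def mem_Collect_eq
    by (intro bexI[of _ "\<lambda>p. a * f p + f' p"] bexI[of _ "\<lambda>p. a * g p + g' p"]
        exI[of _ "\<lambda>v. a * c v + c' v"])
qed

lemma RT_space_sum:
  assumes "finite A" "\<And>i. i \<in> A \<Longrightarrow> H i \<in> RT_space k"
  shows "(\<lambda>p. \<Sum>i\<in>A. c i *\<^sub>R H i p) \<in> RT_space k"
  using assms
proof (induction A rule: finite_induct)
  case empty
  then show ?case
    using RT_space_pairI[OF poly_space_const[of 0] poly_space_const[of 0]] by (simp add: zero_prod_def)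
qed (simp add: RT_space_add_scaled)

lemma divergence_sum:
  assumes "finite A" "\<And>i. i \<in> A \<Longrightarrow> H i \<in> RT_space k"
  shows "divergence (\<lambda>p. \<Sum>i\<in>A. c i *\<^sub>R H i p) p = (\<Sum>i\<in>A. c i * divergence (H i) p)"
  using assms
proof (induction A rule: finite_induct)
  case empty
  then show ?case
    using divergence_eqI[of "\<lambda>p. 0" "\<lambda>p. 0" "\<lambda>p. 0" p] by simp
next
  case (insert i A)
  then show ?case
    using divergence_add_scaled[of "H i" k "\<lambda>p. \<Sum>i\<in>A. c i *\<^sub>R H i p" "c i" p] RT_space_sum[of A H k c]
    by simp
qed

text \<open>The edge is parametrised affinely, so the trace of a polynomial is a polynomial in s of
  no higher degree.\<close>

lemma poly_space_edge_poly:
  assumes "f \<in> poly_space k"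
  obtains q where "Polynomial.degree q \<le> k" "\<And>s. poly q s = f (edge_point e s)"
proof -
  obtain c where f: "\<And>p. f p = (\<Sum>i\<le>k. \<Sum>j\<le>k - i. c i j * (fst p ^ i * snd p ^ j))"
    using poly_spaceE[OF assms] by blast
  define X where "X = [:fst (vertex e), fst (vertex (e + 1)) - fst (vertex e):]"
  define Y where "Y = [:snd (vertex e), snd (vertex (e + 1)) - snd (vertex e):]"
  define q where "q = (\<Sum>i\<le>k. \<Sum>j\<le>k - i. Polynomial.smult (c i j) (X ^ i * Y ^ j))"
  have X: "poly X s = fst (edge_point e s)" and Y: "poly Y s = snd (edge_point e s)" for s
    by (simp_all add: X_def Y_def edge_point_def algebra_simps)
  have "Polynomial.degree (Polynomial.smult (c i j) (X ^ i * Y ^ j)) \<le> k" if "i \<le> k" "j \<le> k - i" for i j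
  proof -
    have "Polynomial.degree X \<le> 1" "Polynomial.degree Y \<le> 1"
      unfolding X_def Y_def by auto
    then have "Polynomial.degree X * i \<le> 1 * i" "Polynomial.degree Y * j \<le> 1 * j"
      by (intro mult_right_mono; simp)+
    then have "Polynomial.degree (X ^ i) \<le> i" "Polynomial.degree (Y ^ j) \<le> j"
      using degree_power_le[of X i] degree_power_le[of Y j] by linarith+
    then show ?thesis
      using degree_smult_le[of "c i j" "X ^ i * Y ^ j"] degree_mult_le[of "X ^ i" "Y ^ j"] that by linarith
  qed
  then have "Polynomial.degree q \<le> k"
    unfolding q_def by (intro degree_sum_le) auto
  moreover have "poly q s = f (edge_point e s)" for s
    by (simp add: q_def f poly_sum X Y)
  ultimately show ?thesis by (rule that)
qed

section \<open>The scheme equation tested against a vector field\<close>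

text \<open>The product over the other nodes meets the definite description, with degree exactly k;
  any other candidate agrees with it at k + 1 distinct nodes.\<close>

lemma edge_lagrange:
  assumes inj: "inj_on (t e) {..k}" and j: "j \<le> k"
  shows "Polynomial.degree (edge_lagrange k t e j) = k"
    "l \<le> k \<Longrightarrow> poly (edge_lagrange k t e j) (t e l) = (if l = j then 1 else 0)"
proof -
  let ?P = "\<lambda>p. Polynomial.degree p = k \<and> (\<forall>l\<le>k. poly p (t e l) = (if l = j then 1 else 0))"
  define w where "w = (\<Prod>l\<in>{..k} - {j}. t e j - t e l)"
  define p where "p = Polynomial.smult (1 / w) (\<Prod>l\<in>{..k} - {j}. [:- t e l, 1:])"
  have w: "w \<noteq> 0"
    using inj j unfolding w_def by (auto simp: inj_on_def)
  have "Polynomial.degree p = (\<Sum>l\<in>{..k} - {j}. 1)"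
    using w unfolding p_def by (simp add: degree_prod_eq_sum_degree)
  also have "\<dots> = k"
    using j by simp
  finally have "Polynomial.degree p = k" .
  moreover have "poly p (t e l) = (if l = j then 1 else 0)" if "l \<le> k" for l
  proof (cases "l = j")
    case False
    then have "(\<Prod>l'\<in>{..k} - {j}. t e l - t e l') = 0"
      using that by (auto simp: prod_zero_iff)
    with False show ?thesis
      by (simp add: p_def poly_prod)
  qed (use w in \<open>simp add: p_def poly_prod w_def\<close>)
  ultimately have "?P p" by simp
  moreover have "q = p" if "?P q" for q
  proof (rule poly_eqI_degree[where A = "t e ` {..k}"])
    show "poly q x = poly p x" if "x \<in> t e ` {..k}" for x
      using that \<open>?P p\<close> \<open>?P q\<close> by auto
    show "Polynomial.degree q < card (t e ` {..k})" "Polynomial.degree p < card (t e ` {..k})"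
      using \<open>?P p\<close> \<open>?P q\<close> card_image[OF inj] by simp_all
  qed
  ultimately have "?P (edge_lagrange k t e j)"
    unfolding edge_lagrange_def by (rule theI)
  then show "Polynomial.degree (edge_lagrange k t e j) = k"
    "l \<le> k \<Longrightarrow> poly (edge_lagrange k t e j) (t e l) = (if l = j then 1 else 0)"
    by auto
qed

lemma edge_lagrange_interpolation:
  assumes inj: "inj_on (t e) {..k}" and q: "Polynomial.degree q \<le> k"
  shows "poly q s = (\<Sum>j\<le>k. poly q (t e j) * poly (edge_lagrange k t e j) s)"
proof -
  note lagrange = edge_lagrange[where t = t and e = e and k = k, OF inj]
  let ?L = "\<Sum>j\<le>k. Polynomial.smult (poly q (t e j)) (edge_lagrange k t e j)"
  have "q = ?L"
  proof (rule poly_eqI_degree[where A = "t e ` {..k}"])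
    show "poly q x = poly ?L x" if x: "x \<in> t e ` {..k}" for x
    proof -
      obtain l where l: "l \<le> k" "x = t e l" using x by auto
      have "poly ?L x = (\<Sum>j\<le>k. if j = l then poly q x else 0)"
        unfolding poly_sum poly_smult
        by (rule sum.cong) (use l lagrange(2) in auto)
      then show ?thesis using l by simp
    qed
    have "Polynomial.degree ?L \<le> k"
    proof (rule degree_sum_le)
      fix j assume "j \<in> {..k}"
      then show "Polynomial.degree (Polynomial.smult (poly q (t e j)) (edge_lagrange k t e j)) \<le> k"
        using degree_smult_le[of _ "edge_lagrange k t e j"] lagrange(1)[of j] by auto
    qed simp
    with q show "Polynomial.degree q < card (t e ` {..k})" "Polynomial.degree ?L < card (t e ` {..k})"
      using card_image[OF inj] by simp_all
  qed
  then have "poly q s = poly ?L s" by metis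
  then show ?thesis by (simp add: poly_sum)
qed

definition boundary_integral :: "(real \<times> real \<Rightarrow> real) \<Rightarrow> (real \<times> real \<Rightarrow> real \<times> real) \<Rightarrow> real" where
  "boundary_integral \<phi> h = (\<Sum>e<3. edge_length e *
     integral {0..1} (\<lambda>s. \<phi> (edge_point e s) * inner (h (edge_point e s)) (outward_normal e)))"

lemma continuous_edge_point: "continuous_on S (edge_point e)"
  unfolding edge_point_def[abs_def] by (intro continuous_intros)

lemma continuous_poly_space:
  assumes "f \<in> poly_space k"
  shows "continuous_on S f"
proof -
  obtain c where "\<And>p. f p = (\<Sum>i\<le>k. \<Sum>j\<le>k - i. c i j * (fst p ^ i * snd p ^ j))"
    using poly_spaceE[OF assms] by blast
  then have "f = (\<lambda>p. \<Sum>i\<le>k. \<Sum>j\<le>k - i. c i j * (fst p ^ i * snd p ^ j))"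
    by (rule ext)
  then show ?thesis
    by (simp only:) (intro continuous_intros)
qed

lemma integrable_edge:
  fixes f :: "real \<times> real \<Rightarrow> real" and h :: "real \<times> real \<Rightarrow> real \<times> real"
  assumes "continuous_on UNIV f" "continuous_on UNIV h"
  shows "(\<lambda>s. f (edge_point e s) * inner (h (edge_point e s)) n) integrable_on {0..1}"
  by (intro integrable_continuous_interval continuous_intros
      continuous_on_compose2[OF assms(1) continuous_edge_point]
      continuous_on_compose2[OF assms(2) continuous_edge_point]) auto

lemma boundary_integral_sum:
  assumes "finite I" "\<And>m. m \<in> I \<Longrightarrow> continuous_on UNIV (\<phi> m)" "continuous_on UNIV h"
  shows "boundary_integral (\<lambda>p. \<Sum>m\<in>I. a m * \<phi> m p) h = (\<Sum>m\<in>I. a m * boundary_integral (\<phi> m) h)"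
proof -
  have "integral {0..1} (\<lambda>s. (\<Sum>m\<in>I. a m * \<phi> m (edge_point e s)) * inner (h (edge_point e s)) (outward_normal e))
      = (\<Sum>m\<in>I. a m * integral {0..1} (\<lambda>s. \<phi> m (edge_point e s) * inner (h (edge_point e s)) (outward_normal e)))" for e
  proof -
    have "integral {0..1} (\<lambda>s. \<Sum>m\<in>I. a m * (\<phi> m (edge_point e s) * inner (h (edge_point e s)) (outward_normal e)))
      = (\<Sum>m\<in>I. integral {0..1} (\<lambda>s. a m * (\<phi> m (edge_point e s) * inner (h (edge_point e s)) (outward_normal e))))"
      by (intro integral_sum integrable_on_cmult_left[where 'b = real, simplified] integrable_edge assms)
    then show ?thesis
      by (simp add: sum_distrib_right mult.assoc)
  qed
  then show ?thesis
    unfolding boundary_integral_def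
    by (simp add: sum_distrib_left mult.left_commute sum.swap[of _ I])
qed

text \<open>Columns are numbered edge by edge, c = e k + j with k points per edge; this regroups a
  sum over columns by edge and flux point.\<close>

lemma sum_div_mod:
  fixes f :: "nat \<Rightarrow> nat \<Rightarrow> 'a::comm_monoid_add"
  shows "(\<Sum>c<n * k. f (c div k) (c mod k)) = (\<Sum>e<n. \<Sum>j<k. f e j)"
proof -
  let ?F = "\<lambda>c. f (c div k) (c mod k)"
  have "sum ?F {e * k..<e * k + k} = (\<Sum>j<k. f e j)" for e
  proof -
    have "sum ?F {0 + e * k..<k + e * k} = (\<Sum>j = 0..<k. ?F (j + e * k))"
      by (rule sum.shift_bounds_nat_ivl)
    also have "\<dots> = (\<Sum>j<k. f e j)"
      by (rule sum.cong) auto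
    finally show ?thesis
      by (simp add: add.commute)
  qed
  then show ?thesis
    using sum.nat_group[of ?F k n] by simp
qed

lemma sum_div_mod_4: "(\<Sum>c<12. f (c div 4) (c mod 4)) = (\<Sum>e<3. \<Sum>j\<le>3. f e j)"
  for f :: "nat \<Rightarrow> nat \<Rightarrow> real"
proof -
  have "(12::nat) = 3 * 4" "{..3::nat} = {..<4}"
    by auto
  then show ?thesis
    using sum_div_mod[where n = 3 and k = 4 and f = f] by (simp only:)
qed

lemma mult_mat_vec_zero:
  fixes A :: "'a::semiring_0 mat"
  assumes "A \<in> carrier_mat n k"
  shows "A *\<^sub>v 0\<^sub>v k = 0\<^sub>v n"
  using assms by (intro eq_vecI) auto

text \<open>Counted from 1, the indices 4, 7, 9 and 10 that occur in Q are the modes (0,3), (1,2),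
  (2,1) and (3,0), those of degree exactly 3.\<close>

lemma Q_entry_low_modes:
  assumes "m \<in> low_modes"
  shows "Q_entry q0 q1 q2 (m + 1, n) = 0"
proof -
  have "m + 1 \<notin> {4, 7, 9, 10}"
    using assms by auto
  then show ?thesis
    by (simp add: Q_entry_def)
qed

text \<open>The equation \<open>scheme_eq\<close> is the common form of the two claims of the
  theorem: the matrix equation gives it once \<open>C_DG\<close> is multiplied by M, and membership
  in \<open>extended_range\<close> once the inverse is cancelled.\<close>

locale sd_scheme =
  fixes t :: "nat \<Rightarrow> nat \<Rightarrow> real" and P :: "(real \<times> real) set" and q0 q1 q2 :: real
  assumes flux: "edge_flux_params 3 t"
    and unisolvent: "SD_unisolvent 3 t P"
    and scheme_eq: "(mass_matrix 3 + Q_matrix q0 q1 q2) * C_SD 3 t P = boundary_matrix 3 t"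
begin

lemma SD_field:
  shows "SD_field 3 t P e j \<in> RT_space 3"
    and "has_SD_dofs 3 t P (\<lambda>e' j'. if e' = e \<and> j' = j then 1 else 0) (\<lambda>_. (0, 0)) (SD_field 3 t P e j)"
proof -
  have "\<exists>!h. h \<in> RT_space 3 \<and> has_SD_dofs 3 t P (\<lambda>e' j'. if e' = e \<and> j' = j then 1 else 0) (\<lambda>_. (0, 0)) h"
    using unisolvent unfolding SD_unisolvent_def by blast
  from theI'[OF this]
  show "SD_field 3 t P e j \<in> RT_space 3"
    "has_SD_dofs 3 t P (\<lambda>e' j'. if e' = e \<and> j' = j then 1 else 0) (\<lambda>_. (0, 0)) (SD_field 3 t P e j)"
    unfolding SD_field_def by auto
qed

text \<open>Both sides lie in RT_3 and have the same degrees of freedom, zero at the interior points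
  and \<open>g\<close> on the boundary, so unisolvence identifies them.\<close>

lemma SD_field_expansion:
  assumes h: "h \<in> RT_space 3" "\<forall>p\<in>P. h p = (0, 0)"
  defines "g \<equiv> (\<lambda>c. inner (h (edge_point (c div 4) (t (c div 4) (c mod 4)))) (outward_normal (c div 4)))"
  shows "h = (\<lambda>p. \<Sum>c<12. g c *\<^sub>R SD_field 3 t P (c div 4) (c mod 4) p)"
proof -
  let ?g = "\<lambda>e j. inner (h (edge_point e (t e j))) (outward_normal e)"
  let ?H = "\<lambda>c. SD_field 3 t P (c div 4) (c mod 4)"
  let ?S = "\<lambda>p. \<Sum>c<12. g c *\<^sub>R ?H c p"
  have "?S \<in> RT_space 3"
    by (intro RT_space_sum SD_field) simp
  moreover have "has_SD_dofs 3 t P ?g (\<lambda>_. (0, 0)) ?S"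
    unfolding has_SD_dofs_def
  proof (intro conjI allI impI ballI)
    fix p assume "p \<in> P"
    then have "?H c p = 0" for c
      using SD_field(2)[of "c div 4" "c mod 4"] unfolding has_SD_dofs_def zero_prod_def by blast
    then show "?S p = (0, 0)"
      by (simp flip: zero_prod_def)
  next
    fix e j :: nat assume e: "e < 3" and j: "j \<le> 3"
    have dof: "inner (?H c (edge_point e (t e j))) (outward_normal e) = (if c = 4 * e + j then 1 else 0)" for c
    proof -
      have "inner (?H c (edge_point e (t e j))) (outward_normal e) = (if e = c div 4 \<and> j = c mod 4 then 1 else 0)"
        using SD_field(2)[of "c div 4" "c mod 4"] e j unfolding has_SD_dofs_def by blast
      moreover have "e = c div 4 \<and> j = c mod 4 \<longleftrightarrow> c = 4 * e + j"
        using j by auto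
      ultimately show ?thesis by simp
    qed
    have "inner (?S (edge_point e (t e j))) (outward_normal e)
        = (\<Sum>c<12. g c * (if c = 4 * e + j then 1 else 0))"
      by (simp only: inner_sum_left inner_scaleR_left dof)
    also have "\<dots> = (\<Sum>c<12. if c = 4 * e + j then g (4 * e + j) else 0)"
      by (intro sum.cong) auto
    also have "\<dots> = g (4 * e + j)"
      using e j by simp
    also have "\<dots> = ?g e j"
      using j by (simp add: g_def)
    finally show "inner (?S (edge_point e (t e j))) (outward_normal e) = ?g e j" .
  qed
  moreover have "has_SD_dofs 3 t P ?g (\<lambda>_. (0, 0)) h"
    using h(2) unfolding has_SD_dofs_def by simp
  ultimately show ?thesis
    using unisolvent h(1) unfolding SD_unisolvent_def by blast
qed

text \<open>The passage from matrices to integrals. \<open>C_SD\<close> sends the normal components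
  of h at the flux points to the coefficients of div h; on the right-hand side, Lagrange
  interpolation recovers h . n exactly, because the components of h have degree at most 3 along each
  edge.\<close>

lemma scheme_vec:
  assumes f: "f1 \<in> poly_space 3" "f2 \<in> poly_space 3"
    and h_def: "h = (\<lambda>p. (f1 p, f2 p))" and zero: "\<forall>p\<in>P. h p = (0, 0)" and m: "m < 10"
  shows "((mass_matrix 3 + Q_matrix q0 q1 q2) *\<^sub>v modal_coeffs 3 (divergence h)) $ m
    = boundary_integral (dubiner 3 (m + 1)) h"
proof -
  let ?A = "mass_matrix 3 + Q_matrix q0 q1 q2"
  let ?H = "\<lambda>c. SD_field 3 t P (c div 4) (c mod 4)"
  let ?g = "\<lambda>e j. inner (h (edge_point e (t e j))) (outward_normal e)"
  have h: "h \<in> RT_space 3"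
    unfolding h_def by (rule RT_space_pairI[OF f])
  have in_span: "divergence h' \<in> mode_span {..<10}" if "h' \<in> RT_space 3" for h'
    using divergence_in_poly_space[OF that] poly_space_3_subset_mode_span by blast
  define g where "g = (\<lambda>c. ?g (c div 4) (c mod 4))"
  have expand: "h = (\<lambda>p. \<Sum>c<12. g c *\<^sub>R ?H c p)"
    unfolding g_def by (rule SD_field_expansion[OF h zero])
  have C: "C_SD 3 t P \<in> carrier_mat 10 12"
    by (simp add: C_SD_def num_modes_def)
  have A: "?A \<in> carrier_mat 10 10"
    using mass_matrix_carrier by (simp add: Q_matrix_def)
  have gv: "Matrix.vec 12 g \<in> carrier_vec 12" by simp
  have entry: "(C_SD 3 t P *\<^sub>v Matrix.vec 12 g) $ n = (\<Sum>c<12. modal_coeffs 3 (divergence (?H c)) $ n * g c)"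
    if "n < 10" for n
    using that by (simp add: C_SD_def num_modes_def scalar_prod_def atLeast0LessThan)
  have coeffs: "modal_coeffs 3 (divergence h) = C_SD 3 t P *\<^sub>v Matrix.vec 12 g"
  proof (rule modal_coeffs_unique)
    show "C_SD 3 t P *\<^sub>v Matrix.vec 12 g \<in> carrier_vec 10"
      using C by simp
    fix p
    have "divergence h p = (\<Sum>c<12. g c * divergence (?H c) p)"
      by (subst expand) (rule divergence_sum[OF _ SD_field(1)], simp)
    also have "\<dots> = (\<Sum>c<12. \<Sum>n<10. g c * (modal_coeffs 3 (divergence (?H c)) $ n * dubiner 3 (n + 1) p))"
      unfolding sum_distrib_left[symmetric]
      by (intro sum.cong refl arg_cong2[of _ _ _ _ "(*)"] modal_coeffs_mode_span(2) in_span SD_field(1))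
    also have "\<dots> = (\<Sum>n<10. \<Sum>c<12. g c * (modal_coeffs 3 (divergence (?H c)) $ n * dubiner 3 (n + 1) p))"
      by (rule sum.swap)
    also have "\<dots> = (\<Sum>n<10. (C_SD 3 t P *\<^sub>v Matrix.vec 12 g) $ n * dubiner 3 (n + 1) p)"
      by (intro sum.cong refl) (simp only: lessThan_iff entry sum_distrib_right sum_distrib_left mult_ac)
    finally show "divergence h p = (\<Sum>n<10. (C_SD 3 t P *\<^sub>v Matrix.vec 12 g) $ n * dubiner 3 (n + 1) p)" .
  qed
  have "(?A *\<^sub>v modal_coeffs 3 (divergence h)) $ m = (boundary_matrix 3 t *\<^sub>v Matrix.vec 12 g) $ m"
    unfolding coeffs assoc_mult_mat_vec[OF A C gv, symmetric] scheme_eq ..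
  also have "\<dots> = (\<Sum>c<12. boundary_matrix 3 t $$ (m, c) * g c)"
    using m by (simp add: boundary_matrix_def num_modes_def scalar_prod_def atLeast0LessThan)
  also have "\<dots> = (\<Sum>c<12. edge_length (c div 4) * integral {0..1}
          (\<lambda>s. dubiner 3 (m + 1) (edge_point (c div 4) s) * poly (edge_lagrange 3 t (c div 4) (c mod 4)) s)
          * ?g (c div 4) (c mod 4))"
    using m by (intro sum.cong refl) (simp add: boundary_matrix_def num_modes_def Let_def g_def)
  also have "\<dots> = (\<Sum>e<3. \<Sum>j\<le>3. edge_length e * integral {0..1}
          (\<lambda>s. dubiner 3 (m + 1) (edge_point e s) * poly (edge_lagrange 3 t e j) s) * ?g e j)"
    by (rule sum_div_mod_4)
  also have "\<dots> = boundary_integral (dubiner 3 (m + 1)) h"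
    unfolding boundary_integral_def
  proof (rule sum.cong)
    fix e :: nat assume "e \<in> {..<3}"
    then have inj: "inj_on (t e) {..3}"
      using flux unfolding edge_flux_params_def by simp
    obtain r1 where r1: "Polynomial.degree r1 \<le> 3" "\<And>s. poly r1 s = f1 (edge_point e s)"
      by (rule poly_space_edge_poly[OF f(1)]) (rule that)
    obtain r2 where r2: "Polynomial.degree r2 \<le> 3" "\<And>s. poly r2 s = f2 (edge_point e s)"
      by (rule poly_space_edge_poly[OF f(2)]) (rule that)
    \<comment> \<open>The outward normal is constant along an edge, so the normal trace is again a
      polynomial of degree at most 3.\<close>
    define r where "r = Polynomial.smult (fst (outward_normal e)) r1 + Polynomial.smult (snd (outward_normal e)) r2"
    have "Polynomial.degree r \<le> 3"
      unfolding r_def using r1(1) r2(1) by (intro degree_add_le) (auto intro: order_trans[OF degree_smult_le])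
    have r: "poly r s = inner (h (edge_point e s)) (outward_normal e)" for s
      by (simp add: r_def r1 r2 h_def inner_prod_def mult.commute)
    define G where "G j = ?g e j" for j
    from \<open>Polynomial.degree r \<le> 3\<close> r
    have trace: "inner (h (edge_point e s)) (outward_normal e) = (\<Sum>j\<le>3. G j * poly (edge_lagrange 3 t e j) s)" for s
      using edge_lagrange_interpolation[where t = t and e = e, OF inj, of r s] by (simp add: G_def)
    have "integral {0..1} (\<lambda>s. dubiner 3 (m + 1) (edge_point e s) * inner (h (edge_point e s)) (outward_normal e))
        = integral {0..1} (\<lambda>s. \<Sum>j\<le>3. dubiner 3 (m + 1) (edge_point e s) * poly (edge_lagrange 3 t e j) s * G j)"
      unfolding trace by (simp only: sum_distrib_left mult_ac)
    also have "\<dots> = (\<Sum>j\<le>3. integral {0..1} (\<lambda>s. dubiner 3 (m + 1) (edge_point e s) * poly (edge_lagrange 3 t e j) s * G j))"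
      using m by (intro integral_sum integrable_continuous_interval continuous_intros
          continuous_on_compose2[OF continuous_dubiner_3 continuous_edge_point]) auto
    also have "\<dots> = (\<Sum>j\<le>3. integral {0..1} (\<lambda>s. dubiner 3 (m + 1) (edge_point e s) * poly (edge_lagrange 3 t e j) s) * G j)"
      by simp
    finally show "(\<Sum>j\<le>3. edge_length e * integral {0..1}
          (\<lambda>s. dubiner 3 (m + 1) (edge_point e s) * poly (edge_lagrange 3 t e j) s) * ?g e j)
        = edge_length e * integral {0..1}
          (\<lambda>s. dubiner 3 (m + 1) (edge_point e s) * inner (h (edge_point e s)) (outward_normal e))"
      by (simp add: sum_distrib_left mult.assoc G_def)
  qed simp
  finally show ?thesis .
qed

text \<open>Linearity in phi reduces the claim to the six low modes, whose rows in M + Q and in M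
  agree.\<close>

lemma divergence_pairing_low_modes:
  assumes f: "f1 \<in> poly_space 3" "f2 \<in> poly_space 3"
    and h_def: "h = (\<lambda>p. (f1 p, f2 p))" and zero: "\<forall>p\<in>P. h p = (0, 0)"
    and \<phi>: "\<phi> \<in> poly_space 2"
  shows "integral ref_triangle (\<lambda>p. \<phi> p * divergence h p) = boundary_integral \<phi> h"
proof -
  let ?d = "\<lambda>m. dubiner 3 (m + 1)"
  let ?c = "modal_coeffs 3 (divergence h)"
  have "\<phi> \<in> mode_span low_modes"
    using \<phi> poly_space_2_subset_mode_span by blast
  then obtain a where a: "\<phi> = (\<lambda>p. \<Sum>m\<in>low_modes. a m * ?d m p)"
    unfolding mode_span_def by blast
  have div: "divergence h \<in> poly_space 3"
    unfolding h_def by (intro divergence_in_poly_space RT_space_pairI f)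
  then have span: "divergence h \<in> mode_span {..<10}"
    using poly_space_3_subset_mode_span by blast
  have c: "?c \<in> carrier_vec 10"
    by (rule modal_coeffs_mode_span(1)[OF span])
  have cont: "continuous_on UNIV (divergence h)" "continuous_on UNIV h"
    by (rule continuous_poly_space[OF div])
      (unfold h_def, intro continuous_on_Pair continuous_poly_space[OF f(1)] continuous_poly_space[OF f(2)])
  have low: "m < 10" "boundary_integral (?d m) h = integral ref_triangle (\<lambda>p. ?d m p * divergence h p)"
    if "m \<in> low_modes" for m
  proof -
    show m: "m < 10" using that by auto
    have "(Q_matrix q0 q1 q2 *\<^sub>v ?c) $ m = (\<Sum>n<10. Q_entry q0 q1 q2 (m + 1, n + 1) * ?c $ n)"
      using m c by (simp add: Q_matrix_def scalar_prod_def atLeast0LessThan)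
    also have "\<dots> = 0"
      by (intro sum.neutral ballI) (simp only: Q_entry_low_modes[OF that] mult_zero_left)
    finally have "((mass_matrix 3 + Q_matrix q0 q1 q2) *\<^sub>v ?c) $ m = (mass_matrix 3 *\<^sub>v ?c) $ m"
      using m c mass_matrix_carrier add_mult_distrib_mat_vec[of "mass_matrix 3" 10 10 "Q_matrix q0 q1 q2" ?c]
      by (simp add: Q_matrix_def)
    also have "\<dots> = integral ref_triangle (\<lambda>p. ?d m p * divergence h p)"
      by (rule mass_matrix_mult_vec[OF c m modal_coeffs_mode_span(2)[OF span]])
    finally show "boundary_integral (?d m) h = integral ref_triangle (\<lambda>p. ?d m p * divergence h p)"
      using scheme_vec[OF f h_def zero m] by simp
  qed
  have "integral ref_triangle (\<lambda>p. \<phi> p * divergence h p)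
      = integral ref_triangle (\<lambda>p. \<Sum>m\<in>low_modes. a m * (?d m p * divergence h p))"
    unfolding a sum_distrib_right by (simp only: mult_ac)
  also have "\<dots> = (\<Sum>m\<in>low_modes. integral ref_triangle (\<lambda>p. a m * (?d m p * divergence h p)))"
    by (intro integral_sum integrable_on_ref_triangle continuous_intros continuous_dubiner_3 cont low(1)) auto
  also have "\<dots> = (\<Sum>m\<in>low_modes. a m * boundary_integral (?d m) h)"
    by (intro sum.cong refl) (simp only: low integral_mult_right)
  also have "\<dots> = boundary_integral \<phi> h"
    unfolding a by (intro boundary_integral_sum[symmetric] continuous_dubiner_3 cont low(1)) auto
  finally show ?thesis .
qed

text \<open>For constant phi this is the divergence theorem; for the other cubics it is a genuine
  restriction on h.\<close>

lemma boundary_pairing_divergence_free: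
  assumes f: "f1 \<in> poly_space 3" "f2 \<in> poly_space 3"
    and h_def: "h = (\<lambda>p. (f1 p, f2 p))" and zero: "\<forall>p\<in>P. h p = (0, 0)"
    and div: "\<And>p. divergence h p = 0" and \<phi>: "\<phi> \<in> poly_space 3"
  shows "boundary_integral \<phi> h = 0"
proof -
  let ?d = "\<lambda>m. dubiner 3 (m + 1)"
  have "\<phi> \<in> mode_span {..<10}"
    using \<phi> poly_space_3_subset_mode_span by blast
  then obtain a where a: "\<phi> = (\<lambda>p. \<Sum>m<10. a m * ?d m p)"
    unfolding mode_span_def by blast
  have cont: "continuous_on UNIV h"
    unfolding h_def by (intro continuous_on_Pair continuous_poly_space[OF f(1)] continuous_poly_space[OF f(2)])
  have c: "modal_coeffs 3 (divergence h) = 0\<^sub>v 10"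
    by (rule modal_coeffs_unique) (auto simp: div)
  have "boundary_integral (?d m) h = 0" if "m < 10" for m
  proof -
    have A: "mass_matrix 3 + Q_matrix q0 q1 q2 \<in> carrier_mat 10 10"
      using mass_matrix_carrier by (simp add: Q_matrix_def)
    have "boundary_integral (?d m) h = ((mass_matrix 3 + Q_matrix q0 q1 q2) *\<^sub>v 0\<^sub>v 10) $ m"
      unfolding c[symmetric] by (rule scheme_vec[OF f h_def zero that, symmetric])
    also have "\<dots> = 0\<^sub>v 10 $ m"
      by (simp only: mult_mat_vec_zero[OF A])
    also have "\<dots> = 0"
      using that by (rule index_zero_vec(1))
    finally show ?thesis .
  qed
  then have "(\<Sum>m<10. a m * boundary_integral (?d m) h) = 0"
    by (intro sum.neutral) auto
  moreover have "boundary_integral \<phi> h = (\<Sum>m<10. a m * boundary_integral (?d m) h)"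
    unfolding a by (intro boundary_integral_sum continuous_dubiner_3 cont) auto
  ultimately show ?thesis by simp
qed

end

section \<open>Three explicit fields\<close>

text \<open>A symbol for 1 / sqrt 3 that the simplifier treats as an atom: with the rules for its
  square, later identities are normalised as polynomials instead of expressions with roots.\<close>

definition \<kappa> :: real where "\<kappa> = 1 / sqrt 3"

lemma \<kappa>_simps: "\<kappa> * \<kappa> = 1 / 3" "\<kappa> * (\<kappa> * z) = z / 3" "\<kappa> > 0"
  by (simp_all add: \<kappa>_def field_simps)

lemma sqrt_3_\<kappa>: "sqrt 3 = 3 * \<kappa>"
  by (simp add: \<kappa>_def field_simps)

section \<open>Edges, normals and integrals along the edges\<close>

lemma edge_points:
  "edge_point 0 s = (2 * s - 1, - \<kappa>)"
  "edge_point 1 s = (1 - s, \<kappa> * (3 * s - 1))"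
  "edge_point 2 s = (- s, \<kappa> * (2 - 3 * s))"
  by (simp_all add: edge_point_def vertex_def \<kappa>_def field_simps)

lemma edge_differences:
  "vertex 1 - vertex 0 = (2, 0)"
  "vertex 2 - vertex 1 = (- 1, sqrt 3)"
  "vertex 3 - vertex 2 = (- 1, - sqrt 3)"
  by (simp_all add: vertex_def field_simps)

lemma norm_edge_differences:
  "norm (2 :: real, 0 :: real) = 2" "norm (- 1 :: real, sqrt 3) = 2" "norm (- 1 :: real, - sqrt 3) = 2"
  by (simp_all add: norm_Pair)

lemma outward_normals:
  "outward_normal 0 = (0, - 1)"
  "outward_normal 1 = (3 * \<kappa> / 2, 1 / 2)"
  "outward_normal 2 = (- (3 * \<kappa> / 2), 1 / 2)"
  unfolding outward_normal_def Let_def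
  by (simp_all add: edge_differences norm_edge_differences numeral_2_eq_2[symmetric] numeral_3_eq_3[symmetric]
      sqrt_3_\<kappa>[symmetric] flip: One_nat_def)

lemma edge_lengths: "edge_length 0 = 2" "edge_length 1 = 2" "edge_length 2 = 2"
  unfolding edge_length_def dist_norm norm_minus_commute[of "vertex e" "vertex (e + 1)" for e]
  by (simp_all add: edge_differences norm_edge_differences flip: One_nat_def)

text \<open>\<open>I0\<close>, \<open>I1\<close> and \<open>I2\<close> are the integrands on the
  three edges in any form that suits integration; the premises are then identities to be checked by
  expansion in s.\<close>

lemma boundary_integral_edges:
  assumes h: "h = (\<lambda>p. (f1 p, f2 p))"
    and e0: "\<And>s. - (\<phi> (2 * s - 1, - \<kappa>) * f2 (2 * s - 1, - \<kappa>)) = I0 s"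
    and e1: "\<And>s. \<phi> (1 - s, \<kappa> * (3 * s - 1)) * (3 * \<kappa> / 2 * f1 (1 - s, \<kappa> * (3 * s - 1)) + f2 (1 - s, \<kappa> * (3 * s - 1)) / 2) = I1 s"
    and e2: "\<And>s. \<phi> (- s, \<kappa> * (2 - 3 * s)) * (- (3 * \<kappa> / 2) * f1 (- s, \<kappa> * (2 - 3 * s)) + f2 (- s, \<kappa> * (2 - 3 * s)) / 2) = I2 s"
  shows "boundary_integral \<phi> h = 2 * integral {0..1} I0 + 2 * integral {0..1} I1 + 2 * integral {0..1} I2"
proof -
  have 3: "{..<3::nat} = {0, 1, 2}" by auto
  have "(\<lambda>s. \<phi> (edge_point 0 s) * inner (h (edge_point 0 s)) (outward_normal 0)) = I0"
    by (rule ext) (simp add: h edge_points outward_normals e0[symmetric])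
  moreover have "(\<lambda>s. \<phi> (edge_point 1 s) * inner (h (edge_point 1 s)) (outward_normal 1)) = I1"
    by (rule ext) (simp add: h edge_points outward_normals e1[symmetric] mult.commute del: One_nat_def)
  moreover have "(\<lambda>s. \<phi> (edge_point 2 s) * inner (h (edge_point 2 s)) (outward_normal 2)) = I2"
    by (rule ext) (simp add: h edge_points outward_normals e2[symmetric] mult.commute)
  ultimately show ?thesis
    unfolding boundary_integral_def 3 by (simp add: edge_lengths del: One_nat_def)
qed

text \<open>s^2 - s is even about the midpoint of the edge, and an integrand with the reflection
  symmetry of the edge is a polynomial in it. The extra factors s and 1 - s come from the test
  function x on the two slanted edges.\<close>

lemma integral_01:
  fixes a b c d :: real
  shows "integral {0..1} (\<lambda>s. a + b * (s\<^sup>2 - s) + c * (s\<^sup>2 - s) ^ 2 + d * (s\<^sup>2 - s) ^ 3) = a - b / 6 + c / 30 - d / 140"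
    and "integral {0..1} (\<lambda>s. s * (a + b * (s\<^sup>2 - s))) = a / 2 - b / 12"
    and "integral {0..1} (\<lambda>s. (1 - s) * (a + b * (s\<^sup>2 - s))) = a / 2 - b / 12"
proof -
  have ftc: "integral {0..1} f = A 1 - A 0"
    if "\<And>s. (A has_real_derivative f s) (at s)" for A f :: "real \<Rightarrow> real"
    using that by (intro integral_unique fundamental_theorem_of_calculus)
      (auto simp: has_real_derivative_iff_has_vector_derivative has_vector_derivative_at_within)
  have "integral {0..1} (\<lambda>s. a + b * (s\<^sup>2 - s) + c * (s\<^sup>2 - s) ^ 2 + d * (s\<^sup>2 - s) ^ 3)
    = (\<lambda>s. a * s + b * (s ^ 3 / 3 - s ^ 2 / 2) + c * (s ^ 5 / 5 - s ^ 4 / 2 + s ^ 3 / 3)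
        + d * (s ^ 7 / 7 - s ^ 6 / 2 + 3 * s ^ 5 / 5 - s ^ 4 / 4)) 1
      - (\<lambda>s. a * s + b * (s ^ 3 / 3 - s ^ 2 / 2) + c * (s ^ 5 / 5 - s ^ 4 / 2 + s ^ 3 / 3)
        + d * (s ^ 7 / 7 - s ^ 6 / 2 + 3 * s ^ 5 / 5 - s ^ 4 / 4)) 0"
    by (rule ftc) (auto intro!: derivative_eq_intros simp: field_simps eval_nat_numeral)
  then show "integral {0..1} (\<lambda>s. a + b * (s\<^sup>2 - s) + c * (s\<^sup>2 - s) ^ 2 + d * (s\<^sup>2 - s) ^ 3) = a - b / 6 + c / 30 - d / 140"
    by simp
  have "integral {0..1} (\<lambda>s. s * (a + b * (s\<^sup>2 - s)))
    = (\<lambda>s. a * s ^ 2 / 2 + b * (s ^ 4 / 4 - s ^ 3 / 3)) 1 - (\<lambda>s. a * s ^ 2 / 2 + b * (s ^ 4 / 4 - s ^ 3 / 3)) 0"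
    by (rule ftc) (auto intro!: derivative_eq_intros simp: field_simps eval_nat_numeral)
  then show "integral {0..1} (\<lambda>s. s * (a + b * (s\<^sup>2 - s))) = a / 2 - b / 12"
    by simp
  have "integral {0..1} (\<lambda>s. (1 - s) * (a + b * (s\<^sup>2 - s)))
    = (\<lambda>s. a * (s - s ^ 2 / 2) + b * (2 * s ^ 3 / 3 - s ^ 4 / 4 - s ^ 2 / 2)) 1
      - (\<lambda>s. a * (s - s ^ 2 / 2) + b * (2 * s ^ 3 / 3 - s ^ 4 / 4 - s ^ 2 / 2)) 0"
    by (rule ftc) (auto intro!: derivative_eq_intros simp: field_simps eval_nat_numeral)
  then show "integral {0..1} (\<lambda>s. (1 - s) * (a + b * (s\<^sup>2 - s))) = a / 2 - b / 12"
    by simp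
qed

(* With c = y^3 - 3 x^2 y and psi = r^4 / 4 - (2 kappa p / 3) c + (2 q / 3) r^2, the pair (field_x, field_y)
   is the gradient of psi, and (field_y, - field_x) is its rotation by a right angle. On the symmetry axis
   x = 0 the derivative of psi is y (y - s1) (y - s2) with s_i = 2 kappa (1 - 3 z_i), the roots being the
   positions of the flux points of (0,2,0); cubic is (y^2 - (s1 + s2) y + s1 s2) ((s1 + s2) y + s1 s2) there. *)
definition field_x :: "real \<Rightarrow> real \<Rightarrow> real \<times> real \<Rightarrow> real" where
  "field_x p q z = fst z * (fst z ^ 2 + snd z ^ 2) + 4 * \<kappa> * p * fst z * snd z + 4 / 3 * q * fst z"

definition field_y :: "real \<Rightarrow> real \<Rightarrow> real \<times> real \<Rightarrow> real" where
  "field_y p q z = snd z * (fst z ^ 2 + snd z ^ 2) - 2 * \<kappa> * p * (snd z ^ 2 - fst z ^ 2) + 4 / 3 * q * snd z"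

definition cubic :: "real \<Rightarrow> real \<Rightarrow> real \<times> real \<Rightarrow> real" where
  "cubic p q z = 2 * \<kappa> * p * (snd z ^ 3 - 3 * fst z ^ 2 * snd z) + 4 / 3 * (q - p\<^sup>2) * (fst z ^ 2 + snd z ^ 2) + 16 / 9 * q\<^sup>2"

text \<open>A template: a given cubic is shown to be in the space by matching its ten
  coefficients.\<close>

lemma poly_space_3_coeffs:
  "(\<lambda>z. c00 + c10 * fst z + c01 * snd z + c20 * fst z ^ 2 + c11 * fst z * snd z + c02 * snd z ^ 2
      + c30 * fst z ^ 3 + c21 * fst z ^ 2 * snd z + c12 * fst z * snd z ^ 2 + c03 * snd z ^ 3) \<in> poly_space 3"
proof -
  have "(\<lambda>z. c00 * (fst z ^ 0 * snd z ^ 0) + c10 * (fst z ^ 1 * snd z ^ 0) + c01 * (fst z ^ 0 * snd z ^ 1)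
      + c20 * (fst z ^ 2 * snd z ^ 0) + c11 * (fst z ^ 1 * snd z ^ 1) + c02 * (fst z ^ 0 * snd z ^ 2)
      + c30 * (fst z ^ 3 * snd z ^ 0) + c21 * (fst z ^ 2 * snd z ^ 1) + c12 * (fst z ^ 1 * snd z ^ 2)
      + c03 * (fst z ^ 0 * snd z ^ 3)) \<in> poly_space 3"
    by (intro poly_space_add poly_space_cmult poly_space_monomial) simp_all
  then show ?thesis
    by (simp add: mult.assoc)
qed

lemma fields_in_poly_space: "field_x p q \<in> poly_space 3" "field_y p q \<in> poly_space 3" "cubic p q \<in> poly_space 3"
proof -
  have "field_x p q = (\<lambda>z. 0 + 4 / 3 * q * fst z + 0 * snd z + 0 * fst z ^ 2 + 4 * \<kappa> * p * fst z * snd z + 0 * snd z ^ 2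
      + 1 * fst z ^ 3 + 0 * fst z ^ 2 * snd z + 1 * fst z * snd z ^ 2 + 0 * snd z ^ 3)"
    by (rule ext) (simp add: field_x_def algebra_simps eval_nat_numeral)
  then show "field_x p q \<in> poly_space 3" by (simp only: poly_space_3_coeffs)
  have "field_y p q = (\<lambda>z. 0 + 0 * fst z + 4 / 3 * q * snd z + 2 * \<kappa> * p * fst z ^ 2 + 0 * fst z * snd z + - 2 * \<kappa> * p * snd z ^ 2
      + 0 * fst z ^ 3 + 1 * fst z ^ 2 * snd z + 0 * fst z * snd z ^ 2 + 1 * snd z ^ 3)"
    by (rule ext) (simp add: field_y_def algebra_simps eval_nat_numeral)
  then show "field_y p q \<in> poly_space 3" by (simp only: poly_space_3_coeffs)
  have "cubic p q = (\<lambda>z. 16 / 9 * q\<^sup>2 + 0 * fst z + 0 * snd z + 4 / 3 * (q - p\<^sup>2) * fst z ^ 2 + 0 * fst z * snd z + 4 / 3 * (q - p\<^sup>2) * snd z ^ 2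
      + 0 * fst z ^ 3 + - 6 * \<kappa> * p * fst z ^ 2 * snd z + 0 * fst z * snd z ^ 2 + 2 * \<kappa> * p * snd z ^ 3)"
    by (rule ext) (simp add: cubic_def field_simps)
  then show "cubic p q \<in> poly_space 3" by (simp only: poly_space_3_coeffs)
qed

text \<open>The first is the Laplacian of psi, in which p disappears because c is harmonic; the
  second vanishes because the mixed derivatives of psi agree.\<close>

lemma divergences:
  "divergence (\<lambda>z. (field_x p q z, field_y p q z)) z = 4 * (fst z ^ 2 + snd z ^ 2) + 8 / 3 * q"
  "divergence (\<lambda>z. (field_y p q z, - field_x p q z)) z = 0"
  "divergence (\<lambda>z. (cubic p q z, 0)) z = - 12 * \<kappa> * p * fst z * snd z + 8 / 3 * (q - p\<^sup>2) * fst z"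
proof -
  have "divergence (\<lambda>z. (field_x p q z, field_y p q z)) z
    = (\<lambda>z. 3 * fst z ^ 2 + snd z ^ 2 + 4 * \<kappa> * p * snd z + 4 / 3 * q) z
    + (\<lambda>z. fst z ^ 2 + 3 * snd z ^ 2 - 4 * \<kappa> * p * snd z + 4 / 3 * q) z"
    by (rule divergence_eqI)
      (auto intro!: derivative_eq_intros simp: field_x_def field_y_def algebra_simps power2_eq_square)
  then show "divergence (\<lambda>z. (field_x p q z, field_y p q z)) z = 4 * (fst z ^ 2 + snd z ^ 2) + 8 / 3 * q"
    by simp
  have "divergence (\<lambda>z. (field_y p q z, - field_x p q z)) z
    = (\<lambda>z. 2 * fst z * snd z + 4 * \<kappa> * p * fst z) z + (\<lambda>z. - (2 * fst z * snd z + 4 * \<kappa> * p * fst z)) z"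
    by (rule divergence_eqI)
      (auto intro!: derivative_eq_intros simp: field_x_def field_y_def algebra_simps power2_eq_square)
  then show "divergence (\<lambda>z. (field_y p q z, - field_x p q z)) z = 0"
    by simp
  have "divergence (\<lambda>z. (cubic p q z, 0)) z
    = (\<lambda>z. - 12 * \<kappa> * p * fst z * snd z + 8 / 3 * (q - p\<^sup>2) * fst z) z + (\<lambda>z. 0) z"
    by (rule divergence_eqI)
      (auto intro!: derivative_eq_intros simp: cubic_def field_simps power2_eq_square)
  then show "divergence (\<lambda>z. (cubic p q z, 0)) z = - 12 * \<kappa> * p * fst z * snd z + 8 / 3 * (q - p\<^sup>2) * fst z"
    by simp
qed

section \<open>Boundary integrals of the three fields\<close>

lemma boundary_radial:
  "boundary_integral (\<lambda>z. fst z ^ 2 + snd z ^ 2) (\<lambda>z. (field_x p q z, field_y p q z))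
    = 6 * \<kappa> * (8 / 15 - 8 / 45 * p + 8 / 9 * q)"
proof -
  \<comment> \<open>The test function and the normal trace are invariant under the rotations of the
    triangle, so one integrand serves all three edges.\<close>
  let ?I = "\<lambda>s::real. \<kappa> * (16 / 9 * (1 - p + q)) + \<kappa> * ((32 - 48 * p + 16 * q) / 3) * (s\<^sup>2 - s)
      + \<kappa> * (16 - 32 * p) * (s\<^sup>2 - s) ^ 2 + 0 * (s\<^sup>2 - s) ^ 3"
  have "boundary_integral (\<lambda>z. fst z ^ 2 + snd z ^ 2) (\<lambda>z. (field_x p q z, field_y p q z))
    = 2 * integral {0..1} ?I + 2 * integral {0..1} ?I + 2 * integral {0..1} ?I"
    by (rule boundary_integral_edges[OF refl])
      (simp_all add: field_x_def field_y_def field_simps eval_nat_numeral \<kappa>_simps)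
  then show ?thesis
    unfolding integral_01 by (simp add: field_simps)
qed

lemma boundary_rotated:
  "boundary_integral (\<lambda>z. fst z ^ 3 - 3 * fst z * snd z ^ 2) (\<lambda>z. (field_y p q z, - field_x p q z))
    = - 16 / 105 * (4 - 7 * p + 7 * q)"
proof -
  \<comment> \<open>The normal component is the derivative of psi along the edge, odd about the
    midpoint like the test function, so the product is even. The constant term is 0 because the test
    function vanishes at the vertices.\<close>
  let ?I = "\<lambda>s::real. 0 + (4 + 4 / 3 * (1 - 4 * p + 4 * q)) * (s\<^sup>2 - s)
      + (32 + 16 / 3 * (1 - 4 * p + 4 * q)) * (s\<^sup>2 - s) ^ 2 + 64 * (s\<^sup>2 - s) ^ 3"
  have "boundary_integral (\<lambda>z. fst z ^ 3 - 3 * fst z * snd z ^ 2) (\<lambda>z. (field_y p q z, - field_x p q z))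
    = 2 * integral {0..1} ?I + 2 * integral {0..1} ?I + 2 * integral {0..1} ?I"
    by (rule boundary_integral_edges[OF refl])
      (simp_all add: field_x_def field_y_def field_simps eval_nat_numeral \<kappa>_simps)
  then show ?thesis
    unfolding integral_01 by (simp add: field_simps)
qed

lemma boundary_horizontal:
  "boundary_integral fst (\<lambda>z. (cubic p q z, 0)) = 6 * \<kappa> * (2 / 9 * p + 4 / 9 * (q - p\<^sup>2) + 8 / 9 * q\<^sup>2)"
proof -
  \<comment> \<open>The normal of the bottom edge is vertical, so that edge contributes 0. On the
    other two, the signs of x and of the normal cancel, and \<open>cubic\<close> restricts to the
    same even polynomial by rotation invariance.\<close>
  let ?a = "3 * \<kappa> / 2 * (16 / 9 * p + 16 / 9 * (q - p\<^sup>2) + 16 / 9 * q\<^sup>2)"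
  let ?b = "3 * \<kappa> / 2 * (8 * p + 16 / 3 * (q - p\<^sup>2))"
  have "boundary_integral fst (\<lambda>z. (cubic p q z, 0))
    = 2 * integral {0..1} (\<lambda>s::real. 0) + 2 * integral {0..1} (\<lambda>s. (1 - s) * (?a + ?b * (s\<^sup>2 - s)))
      + 2 * integral {0..1} (\<lambda>s. s * (?a + ?b * (s\<^sup>2 - s)))"
    by (rule boundary_integral_edges[OF refl])
      (simp_all add: cubic_def field_simps eval_nat_numeral \<kappa>_simps)
  then show ?thesis
    unfolding integral_01 by (simp add: field_simps)
qed

section \<open>The three equations for p and q\<close>

context sd_scheme
begin

text \<open>The gradient of r^2 is twice the position vector, so the condition tested here is that
  the radial component r d(psi)/dr has mean 0 over the triangle.\<close>

lemma radial_equation: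
  assumes "\<forall>z\<in>P. field_x p q z = 0 \<and> field_y p q z = 0"
  shows "2 - 2 * p + 5 * q = 0"
proof -
  have r2: "(\<lambda>z. fst z ^ 2 + snd z ^ 2) \<in> poly_space 2"
    using poly_space_add[OF poly_space_monomial[of 2 0 2] poly_space_monomial[of 0 2 2]] by simp
  have int: "(\<lambda>z. 4 * (fst z ^ 2 + snd z ^ 2) ^ 2) integrable_on ref_triangle"
    "(\<lambda>z. 8 / 3 * q * (fst z ^ 2 + snd z ^ 2)) integrable_on ref_triangle"
    by (intro integrable_on_ref_triangle continuous_intros)+
  have "integral ref_triangle (\<lambda>z. (fst z ^ 2 + snd z ^ 2) * divergence (\<lambda>z. (field_x p q z, field_y p q z)) z)
      = 6 * \<kappa> * (8 / 15 - 8 / 45 * p + 8 / 9 * q)"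
    unfolding boundary_radial[symmetric]
    by (rule divergence_pairing_low_modes[OF fields_in_poly_space(1, 2) refl _ r2]) (use assms in simp)
  moreover have "integral ref_triangle (\<lambda>z. (fst z ^ 2 + snd z ^ 2) * divergence (\<lambda>z. (field_x p q z, field_y p q z)) z)
      = integral ref_triangle (\<lambda>z. 4 * (fst z ^ 2 + snd z ^ 2) ^ 2 + 8 / 3 * q * (fst z ^ 2 + snd z ^ 2))"
    unfolding divergences by (simp only: power2_eq_square[of "_ + _"] algebra_simps)
  moreover have "\<dots> = 4 * (8 * sqrt 3 / 45) + 8 / 3 * q * (sqrt 3 / 3)"
    unfolding integral_add[OF int] integral_mult_right triangle_moments ..
  ultimately have "\<kappa> * (2 - 2 * p + 5 * q) = 0"
    unfolding sqrt_3_\<kappa> by (simp add: field_simps)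
  then show ?thesis
    using \<kappa>_simps(3) by simp
qed

lemma rotated_equation:
  assumes "\<forall>z\<in>P. field_x p q z = 0 \<and> field_y p q z = 0"
  shows "4 - 7 * p + 7 * q = 0"
proof -
  have m: "- field_x p q z = - 1 * field_x p q z" for z
    by simp
  have field_x: "(\<lambda>z. - field_x p q z) \<in> poly_space 3"
    unfolding m by (intro poly_space_cmult fields_in_poly_space)
  have "(\<lambda>z. 1 * (fst z ^ 3 * snd z ^ 0) + - 3 * (fst z ^ 1 * snd z ^ 2)) \<in> poly_space 3"
    by (intro poly_space_lincomb poly_space_monomial) simp_all
  then have c: "(\<lambda>z. fst z ^ 3 - 3 * fst z * snd z ^ 2) \<in> poly_space 3"
    by (simp add: mult.assoc)
  have "boundary_integral (\<lambda>z. fst z ^ 3 - 3 * fst z * snd z ^ 2) (\<lambda>z. (field_y p q z, - field_x p q z)) = 0"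
    by (rule boundary_pairing_divergence_free[OF fields_in_poly_space(2) field_x refl _ divergences(2) c])
      (use assms in simp)
  then show ?thesis
    unfolding boundary_rotated by simp
qed

text \<open>With phi = x the pairing expresses, by the divergence theorem, that \<open>cubic\<close>
  has mean 0 over the triangle.\<close>

lemma horizontal_equation:
  assumes "\<forall>z\<in>P. cubic p q z = 0"
  shows "p / 10 + (q - p\<^sup>2) / 4 + q\<^sup>2 = 0"
proof -
  have x: "fst \<in> poly_space 2"
    using poly_space_monomial[of 1 0 2] by simp
  have int: "(\<lambda>z. - 12 * \<kappa> * p * (fst z ^ 2 * snd z)) integrable_on ref_triangle"
    "(\<lambda>z. 8 / 3 * (q - p\<^sup>2) * fst z ^ 2) integrable_on ref_triangle"
    by (intro integrable_on_ref_triangle continuous_intros)+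
  have "integral ref_triangle (\<lambda>z. fst z * divergence (\<lambda>z. (cubic p q z, 0)) z)
      = 6 * \<kappa> * (2 / 9 * p + 4 / 9 * (q - p\<^sup>2) + 8 / 9 * q\<^sup>2)"
    unfolding boundary_horizontal[symmetric]
    by (rule divergence_pairing_low_modes[OF fields_in_poly_space(3) poly_space_const refl _ x]) (use assms in simp)
  moreover have "integral ref_triangle (\<lambda>z. fst z * divergence (\<lambda>z. (cubic p q z, 0)) z)
      = integral ref_triangle (\<lambda>z. - 12 * \<kappa> * p * (fst z ^ 2 * snd z) + 8 / 3 * (q - p\<^sup>2) * fst z ^ 2)"
    unfolding divergences by (simp add: power2_eq_square algebra_simps)
  moreover have "\<dots> = - 12 * \<kappa> * p * (- 1 / 15) + 8 / 3 * (q - p\<^sup>2) * (sqrt 3 / 6)"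
    unfolding integral_add[OF int] integral_mult_right triangle_moments ..
  ultimately have "\<kappa> * (p / 10 + (q - p\<^sup>2) / 4 + q\<^sup>2) = 0"
    unfolding sqrt_3_\<kappa> by (simp add: field_simps)
  then show ?thesis
    using \<kappa>_simps(3) by simp
qed

lemma vanishing_fields_impossible:
  assumes "\<forall>z\<in>P. field_x p q z = 0 \<and> field_y p q z = 0 \<and> cubic p q z = 0"
  shows False
proof -
  have "2 - 2 * p + 5 * q = 0" "4 - 7 * p + 7 * q = 0"
    using assms by (auto intro: radial_equation rotated_equation)
  \<comment> \<open>The two linear equations leave this single point, at which the quadratic
    expression takes the value 9 / 490.\<close>
  then have "p = 2 / 7" "q = - 2 / 7"
    by linarith+
  moreover have "p / 10 + (q - p\<^sup>2) / 4 + q\<^sup>2 = 0"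
    using assms by (auto intro: horizontal_equation)
  ultimately have "2 / 7 / 10 + (- 2 / 7 - (2 / 7)\<^sup>2) / 4 + (- 2 / 7)\<^sup>2 = (0 :: real)"
    by (simp only:)
  then show False
    by (simp add: power2_eq_square)
qed

end

section \<open>Vanishing of the fields at the interior flux points\<close>

lemma barycentric_coords: "barycentric a b c = (b - a, \<kappa> * (2 * c - a - b))"
  by (simp add: barycentric_def vertex_def \<kappa>_def field_simps)

text \<open>An orbit of (z, z, 1 - 2 z) has one point on each symmetry axis, at signed distance 2
  kappa a from the centroid with a = 1 - 3 z.\<close>

lemma config_020_cases:
  assumes "P \<in> config_020 z1 z2"
  obtains a where "a = 1 - 3 * z1 \<or> a = 1 - 3 * z2"
    "P = (0, 2 * \<kappa> * a) \<or> P = (a, - \<kappa> * a) \<or> P = (- a, - \<kappa> * a)"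
proof -
  have orbit: "P = (0, 2 * \<kappa> * (1 - 3 * z)) \<or> P = (1 - 3 * z, - \<kappa> * (1 - 3 * z)) \<or> P = (- (1 - 3 * z), - \<kappa> * (1 - 3 * z))"
    if "P \<in> bary_orbit z z (1 - 2 * z)" for z
    using that unfolding bary_orbit_def barycentric_coords by (auto simp: algebra_simps)
  show ?thesis
    using assms orbit[of z1] orbit[of z2] that[of "1 - 3 * z1"] that[of "1 - 3 * z2"]
    unfolding config_020_def by blast
qed

text \<open>p and q are the sum and the product of the two values of a, so a^2 - p a + q = 0 at each
  flux point, and all field components there are multiples of this expression.\<close>

lemma fields_vanish_config_020:
  assumes "P \<in> config_020 z1 z2"
  defines "p \<equiv> (1 - 3 * z1) + (1 - 3 * z2)" and "q \<equiv> (1 - 3 * z1) * (1 - 3 * z2)"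
  shows "field_x p q P = 0 \<and> field_y p q P = 0 \<and> cubic p q P = 0"
proof -
  obtain a where a: "a = 1 - 3 * z1 \<or> a = 1 - 3 * z2"
    and P: "P = (0, 2 * \<kappa> * a) \<or> P = (a, - \<kappa> * a) \<or> P = (- a, - \<kappa> * a)"
    by (rule config_020_cases[OF assms(1)])
  have root: "a * a - p * a + q = 0"
  proof -
    have "a * a - p * a + q = (a - (1 - 3 * z1)) * (a - (1 - 3 * z2))"
      unfolding p_def q_def by (simp add: algebra_simps)
    then show ?thesis using a by auto
  qed
  have "field_x p q P = 0 \<or> field_x p q P = 4 / 3 * a * (a * a - p * a + q) \<or> field_x p q P = - (4 / 3 * a * (a * a - p * a + q))"
    using P by (auto simp: field_x_def field_simps eval_nat_numeral \<kappa>_simps)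
  moreover have "field_y p q P = 8 / 3 * \<kappa> * a * (a * a - p * a + q) \<or> field_y p q P = - (4 / 3 * \<kappa> * a * (a * a - p * a + q))"
    using P by (auto simp: field_y_def field_simps eval_nat_numeral \<kappa>_simps)
  moreover have "cubic p q P = 16 / 9 * (p * a + q) * (a * a - p * a + q)"
    using P by (auto simp: cubic_def field_simps eval_nat_numeral \<kappa>_simps)
  ultimately show ?thesis
    unfolding root by auto
qed

lemma fields_vanish_config_001:
  obtains q where "\<forall>P\<in>config_001 z1 z2. field_x 0 q P = 0 \<and> field_y 0 q P = 0 \<and> cubic 0 q P = 0"
proof -
  define z3 where "z3 = 1 - z1 - z2"
  \<comment> \<open>r^2 is 4/3 times the form in parentheses, which is symmetric in the barycentric
    coordinates and hence the same at all six points.\<close>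
  define q where "q = - (z1\<^sup>2 + z2\<^sup>2 + z3\<^sup>2 - z1 * z2 - z2 * z3 - z3 * z1)"
  have "fst P ^ 2 + snd P ^ 2 = - (4 / 3 * q)" if "P \<in> config_001 z1 z2" for P
    using that unfolding config_001_def bary_orbit_def barycentric_coords z3_def[symmetric] q_def
    by (auto simp: field_simps power2_eq_square \<kappa>_simps)
  then have "\<forall>P\<in>config_001 z1 z2. field_x 0 q P = 0 \<and> field_y 0 q P = 0 \<and> cubic 0 q P = 0"
    by (simp add: field_x_def field_y_def cubic_def power2_eq_square)
  then show ?thesis by (rule that)
qed

lemma no_sd_scheme:
  assumes "config \<in> {config_020, config_001}"
  shows "\<not> sd_scheme t (config z1 z2) q0 q1 q2"
proof
  assume "sd_scheme t (config z1 z2) q0 q1 q2"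
  then interpret sd_scheme t "config z1 z2" q0 q1 q2 .
  obtain p q where "\<forall>z\<in>config z1 z2. field_x p q z = 0 \<and> field_y p q z = 0 \<and> cubic p q z = 0"
    using assms fields_vanish_config_020 fields_vanish_config_001 by (metis insert_iff singletonD)
  then show False
    by (rule vanishing_fields_impossible)
qed

lemma mat_inverse_mult_cancel:
  assumes "positive_definite n A" "B \<in> carrier_mat n k"
  shows "A * (the (mat_inverse A) * B) = B"
proof -
  have "A \<in> carrier_mat n n"
    using assms unfolding positive_definite_def by simp
  from assoc_mult_mat[OF this positive_definite_inverse(1)[OF assms(1)] assms(2)]
  show ?thesis
    using positive_definite_inverse(2)[OF assms(1)] assms(2) by simp
qed

theorem mainTheorem11:
  fixes t :: "nat \<Rightarrow> nat \<Rightarrow> real"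
    and config :: "real \<Rightarrow> real \<Rightarrow> (real \<times> real) set"
  assumes "edge_flux_params 3 t"
    and "config \<in> {config_020, config_001}"
  shows
    "\<not> (\<exists>z1 z2 q0 q1 q2.
          card (config z1 z2) = 6 \<and> config z1 z2 \<subseteq> ref_triangle \<and>
          SD_unisolvent 3 t (config z1 z2) \<and>
          Q_matrix q0 q1 q2 * C_SD 3 t (config z1 z2)
            + mass_matrix 3 * (C_SD 3 t (config z1 z2) - C_DG 3 t) = 0\<^sub>m 10 12)
     \<and> \<not> (\<exists>z1 z2.
          card (config z1 z2) = 6 \<and> config z1 z2 \<subseteq> ref_triangle \<and>
          SD_unisolvent 3 t (config z1 z2) \<and>
          C_SD 3 t (config z1 z2) \<in> extended_range t)"
proof -
  let ?M = "mass_matrix 3"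
  have B: "boundary_matrix 3 t \<in> carrier_mat 10 12"
    by (simp add: boundary_matrix_def num_modes_def)
  have M: "?M \<in> carrier_mat 10 10"
    by (rule mass_matrix_carrier)
  have DG: "C_DG 3 t \<in> carrier_mat 10 12" "?M * C_DG 3 t = boundary_matrix 3 t"
    using positive_definite_inverse(1)[OF mass_matrix_positive_definite]
      mat_inverse_mult_cancel[OF mass_matrix_positive_definite B] B
    unfolding C_DG_def by auto
  have C: "C_SD 3 t P \<in> carrier_mat 10 12" for P
    by (simp add: C_SD_def num_modes_def)
  have Q: "Q_matrix q0 q1 q2 \<in> carrier_mat 10 10" for q0 q1 q2
    by (simp add: Q_matrix_def)
  have False
    if unisolvent: "SD_unisolvent 3 t (config z1 z2)"
      and eq: "Q_matrix q0 q1 q2 * C_SD 3 t (config z1 z2)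
            + ?M * (C_SD 3 t (config z1 z2) - C_DG 3 t) = 0\<^sub>m 10 12" for z1 z2 q0 q1 q2
  proof -
    let ?C = "C_SD 3 t (config z1 z2)" and ?Q = "Q_matrix q0 q1 q2"
    have MC: "?M * ?C \<in> carrier_mat 10 12" and QC: "?Q * ?C \<in> carrier_mat 10 12"
      using mult_carrier_mat[OF M C] mult_carrier_mat[OF Q C] by blast+
    \<comment> \<open>Since M times \<open>C_DG\<close> is the boundary matrix, the given equation
      becomes (M + Q) C_SD = L^T W after rearranging entry by entry.\<close>
    have zero: "?Q * ?C + (?M * ?C - boundary_matrix 3 t) = 0\<^sub>m 10 12"
      using eq unfolding mult_minus_distrib_mat[OF M C DG(1)] DG(2) .
    have "(?M * ?C) $$ (i, j) + (?Q * ?C) $$ (i, j) = boundary_matrix 3 t $$ (i, j)" if "i < 10" "j < 12" for i j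
      using arg_cong[OF zero, of "\<lambda>X. X $$ (i, j)"] that B MC QC
      by (simp del: index_mult_mat(1))
    then have "?M * ?C + ?Q * ?C = boundary_matrix 3 t"
      using B M Q[of q0 q1 q2] C[of "config z1 z2"]
      by (intro eq_matI) (auto simp del: index_mult_mat(1))
    then have "(?M + ?Q) * ?C = boundary_matrix 3 t"
      unfolding add_mult_distrib_mat[OF M Q C] .
    then show False
      using no_sd_scheme[OF assms(2)] assms(1) unisolvent unfolding sd_scheme_def by blast
  qed
  moreover have False
    if unisolvent: "SD_unisolvent 3 t (config z1 z2)"
      and ext: "C_SD 3 t (config z1 z2) \<in> extended_range t" for z1 z2
  proof -
    obtain q0 q1 q2 where "positive_definite 10 (?M + Q_matrix q0 q1 q2)"
      and "C_SD 3 t (config z1 z2) = the (mat_inverse (?M + Q_matrix q0 q1 q2)) * boundary_matrix 3 t"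
      using ext unfolding extended_range_def by blast
    \<comment> \<open>Positive definiteness makes the inverse in \<open>extended_range\<close>
      genuine, so multiplying by M + Q cancels it.\<close>
    then have "(?M + Q_matrix q0 q1 q2) * C_SD 3 t (config z1 z2) = boundary_matrix 3 t"
      using mat_inverse_mult_cancel[OF _ B] by simp
    then show False
      using no_sd_scheme[OF assms(2)] assms(1) unisolvent unfolding sd_scheme_def by blast
  qed
  ultimately show ?thesis by blast
qed

end
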